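(* Assume (A0), (A1'), (A2') and (A3') (stated in the context) hold, and let $\alpha_n$ be a positive sequence with $\frac1n\ll\alpha_n\ll1$. Let $\hat\theta^{\mathrm B}=[\hat\theta_1^{\mathrm B},\dots,\hat\theta_p^{\mathrm B}]^\top$ be the $\alpha_n$-posterior mean, $\hat\theta^{\mathrm B}_j=\int_{\mathbb R^p}\theta_j\,\pi_{n,\alpha_n}(\theta|X^n)\,d\theta$ for $j=1,\dots,p$. Then $$\hat\theta^{\mathrm B}-\hat\theta=O_{f_{0,n}}\Big(\frac1{\alpha_nn}\Big).$$ Furthermore, suppose that for a data-dependent, positive sequence $\hat\alpha_n$ there exists a positive sequence $\alpha_n$ with $\frac1n\ll\alpha_n\ll1$ such that $\hat\alpha_n/\alpha_n\to1$ in $f_{0,n}$-probability. Then the displayed result holds with $\pi_{n,\alpha_n}(\theta|X^n)$ replaced by $\pi_{n,\hat\alpha_n}(\theta|X^n)$ in the definition of $\hat\theta^{\mathrm B}$.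
   Context: Setting. For each $n$, $X^n=(X_1,\dots,X_n)\in\mathcal X^n$ ($\mathcal X\subset\mathbb R^d$) is a random sample with true density $f_{0,n}$; $\mathbb P_{f_{0,n}}$ is the corresponding probability. $\{f_n(\cdot|\theta):\theta\in\Theta\subset\mathbb R^p\}$ is a parametric family of densities, possibly misspecified. $\hat\theta=\arg\max_\theta f_n(X^n|\theta)$ is the MLE and $\pi$ is a prior density. For $\alpha>0$ the $\alpha$-posterior has density $\pi_{n,\alpha}(\theta|X^n)=f_n(X^n|\theta)^\alpha\pi(\theta)/\int_{\mathbb R^p}f_n(X^n|\theta)^\alpha\pi(\theta)\,d\theta$; the $\hat\alpha_n$-posterior is obtained by plugging in a data-dependent $\hat\alpha_n$. All these posteriors are assumed proper. Integrands in $\theta$ are understood as zero outside $\Theta$. $a_n\ll b_n$ means $a_n/b_n\to0$. $Y_n=O_{f_{0,n}}(1)$ means: for every $\epsilon>0$ there is $M>0$ with $\mathbb P_{f_{0,n}}(\|Y_n\|_2>M)<\epsilon$ for all sufficiently large $n$; $Y_n=O_{f_{0,n}}(a_n)$ means $Y_n/a_n=O_{f_{0,n}}(1)$. $B_v(r)$ is the open Euclidean ball. For a tensor $S\in\mathbb R^{p\times p\times p}$, $\langle S,h^{\otimes3}\rangle=\sum_{i,j,k}S_{ijk}h_ih_jh_k$. Assumptions; $\alpha_n$ denotes an arbitrary positive sequence with $\frac1n\ll\alpha_n\ll1$. (A0) The MLE $\hat\theta$ is unique and there exists $\theta^*\in\Theta$, with $\Theta$ an open subset of $\mathbb R^p$,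 such that $\hat\theta\to\theta^*$ in $f_{0,n}$-probability and $\sqrt n(\hat\theta-\theta^* )$ is asymptotically normal. (A1') The prior $\pi$ is positive and twice continuously differentiable in an open ball around $\theta^*$, and the prior mean is finite. (A2') For $n$ sufficiently large there exist a (data-dependent) matrix $H_n\in\mathbb R^{p\times p}$ that is symmetric and positive definite with probability tending to one, a tensor $S_n\in\mathbb R^{p\times p\times p}$, and a constant $M<\infty$ such that for all $\epsilon>0$ and some $\delta>0$, $$\mathbb P_{f_{0,n}}\Big(\sup_{h\in\mathcal H_n}\Big\{|\tilde R_n(h)|-\frac{M}{\alpha_nn}\|h\|_2^4\Big\}>0\Big)<\epsilon,$$ where $\mathcal H_n=\{h\in\mathbb R^p:\|h\|_2/\sqrt{\alpha_nn}\le\delta\}$ and $$\tilde R_n(h)=\alpha_n\Big[\log f_n\Big(X^n\Big|\hat\theta+\tfrac{h}{\sqrt{\alpha_nn}}\Big)-\log f_n(X^n|\hat\theta)\Big]+\tfrac12h^\top H_nh-\tfrac{1}{6\sqrt{\alpha_nn}}\langle S_n,h^{\otimes3}\rangle.$$ (A3') For all $\epsilon>0$ and $\delta'>0$ there exists $c=c(\epsilon,\delta')>0$ such that for $n$ sufficiently large $$\mathbb P_{f_{0,n}}\Big(\sup_{\theta\in B_{\hat\theta}(\delta')^{\mathsf c}}\Big\{\tfrac1n\log f_n(X^n|\theta)-\tfrac1n\log f_n(X^n|\hat\theta)\Big\}>-c\Big)<\epsilon.$$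
   Formalization: In (A2') the matrix H_n is additionally required to satisfy H_n = O(1) and H_n^{-1} = O(1) in f_{0,n}-probability; with mere positive definiteness the claim fails, e.g. for log-likelihood ratio -n(2^{-n}t^2/2 + t^4), t = θ − θ̂, and a sloped prior. *)

theory Defs
  imports "HOL-Probability.Probability"
begin

section \<open>Sampling model\<close>

text \<open>
  A sample of size n is a function on \<open>{..<n}\<close> with values in \<open>X\<close>, and a density on the n-fold
  product of \<open>X\<close> is taken with respect to the n-fold product of a sigma-finite measure on \<open>X\<close>
  (for instance Lebesgue or counting measure).  Observations need be neither independent nor
  identically distributed under \<open>f0 n\<close>.  All requirements are imposed for \<open>n \<ge> 1\<close> only.
\<close>

type_synonym 'd sample = "nat \<Rightarrow> real ^ 'd"

definition sample_space :: "(real ^ 'd) measure \<Rightarrow> nat \<Rightarrow> 'd sample measure" where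
  "sample_space \<nu> n = PiM {..<n} (\<lambda>_. \<nu>)"

definition prob_density :: "'a measure \<Rightarrow> ('a \<Rightarrow> real) \<Rightarrow> bool" where
  "prob_density M g \<longleftrightarrow> g \<in> borel_measurable M \<and> (\<forall>x\<in>space M. 0 \<le> g x) \<and>
     (\<integral>\<^sup>+x. ennreal (g x) \<partial>M) = 1"

definition sample_law ::
    "(real ^ 'd) measure \<Rightarrow> (nat \<Rightarrow> 'd sample \<Rightarrow> real) \<Rightarrow> nat \<Rightarrow> 'd sample measure" where
  "sample_law \<nu> f0 n = density (sample_space \<nu> n) (\<lambda>x. ennreal (f0 n x))"

definition statistical_model ::
    "(real ^ 'd) set \<Rightarrow> (real ^ 'd) measure \<Rightarrow> (nat \<Rightarrow> 'd sample \<Rightarrow> real) \<Rightarrow> (real ^ 'p) set \<Rightarrow>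
     (nat \<Rightarrow> real ^ 'p \<Rightarrow> 'd sample \<Rightarrow> real) \<Rightarrow> (real ^ 'p \<Rightarrow> real) \<Rightarrow> bool" where
  "statistical_model X \<nu> f0 \<Theta> f \<pi> \<longleftrightarrow>
     sigma_finite_measure \<nu> \<and> sets \<nu> = sets (restrict_space borel X) \<and>
     (\<forall>n\<ge>1. prob_density (sample_space \<nu> n) (f0 n)) \<and>
     (\<forall>n\<ge>1. \<forall>\<theta>\<in>\<Theta>. prob_density (sample_space \<nu> n) (f n \<theta>)) \<and>
     (\<forall>\<theta>\<in>\<Theta>. 0 \<le> \<pi> \<theta>) \<and> set_integrable lborel \<Theta> \<pi> \<and> (LINT \<theta>:\<Theta>|lborel. \<pi> \<theta>) = 1"

section \<open>Stochastic order notation\<close>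

text \<open>
  Here \<open>P\<close> is a sequence of laws on changing sample spaces.  Probabilities of events are outer
  probabilities: these are the ordinary probabilities whenever the event is measurable, whereas
  \<open>measure\<close> and \<open>emeasure\<close> silently return 0 on the possibly non-measurable events below
  (suprema over uncountable sets).
\<close>

definition pr :: "'a measure \<Rightarrow> ('a \<Rightarrow> bool) \<Rightarrow> ennreal" where
  "pr M E = outer_measure_of M {x \<in> space M. E x}"

definition conv_in_prob ::
    "(nat \<Rightarrow> 'a measure) \<Rightarrow> (nat \<Rightarrow> 'a \<Rightarrow> 'b::metric_space) \<Rightarrow> 'b \<Rightarrow> bool" where
  "conv_in_prob P Y c \<longleftrightarrow> (\<forall>\<epsilon>>0. (\<lambda>n. pr (P n) (\<lambda>x. dist (Y n x) c > \<epsilon>)) \<longlonglongrightarrow> 0)"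

definition O_prob ::
    "(nat \<Rightarrow> 'a measure) \<Rightarrow> (nat \<Rightarrow> 'a \<Rightarrow> 'b::real_normed_vector) \<Rightarrow> (nat \<Rightarrow> real) \<Rightarrow> bool" where
  "O_prob P Y a \<longleftrightarrow>
     (\<forall>\<epsilon>>0. \<exists>M>0. \<forall>\<^sub>F n in sequentially. pr (P n) (\<lambda>x. norm (Y n x /\<^sub>R a n) > M) < ennreal \<epsilon>)"

definition much_less :: "(nat \<Rightarrow> real) \<Rightarrow> (nat \<Rightarrow> real) \<Rightarrow> bool" where
  "much_less a b \<longleftrightarrow> (\<lambda>n. a n / b n) \<longlonglongrightarrow> 0"

definition tempering_rate :: "(nat \<Rightarrow> real) \<Rightarrow> bool" where
  "tempering_rate \<alpha> \<longleftrightarrow> (\<forall>n\<ge>1. 0 < \<alpha> n) \<and> much_less (\<lambda>n. 1 / real n) \<alpha> \<and> much_less \<alpha> (\<lambda>_. 1)"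

section \<open>Posteriors\<close>

text \<open>The set integral over \<open>\<Theta>\<close> is the integral of the integrand extended by zero.\<close>

definition posterior_density ::
    "(real ^ 'p) set \<Rightarrow> (nat \<Rightarrow> real ^ 'p \<Rightarrow> 'x \<Rightarrow> real) \<Rightarrow> (real ^ 'p \<Rightarrow> real) \<Rightarrow>
     nat \<Rightarrow> real \<Rightarrow> 'x \<Rightarrow> real ^ 'p \<Rightarrow> real" where
  "posterior_density \<Theta> f \<pi> n a x \<theta> =
     (f n \<theta> x powr a * \<pi> \<theta>) / (LINT \<tau>:\<Theta>|lborel. f n \<tau> x powr a * \<pi> \<tau>)"

definition posterior_mean ::
    "(real ^ 'p) set \<Rightarrow> (nat \<Rightarrow> real ^ 'p \<Rightarrow> 'x \<Rightarrow> real) \<Rightarrow> (real ^ 'p \<Rightarrow> real) \<Rightarrow>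
     nat \<Rightarrow> real \<Rightarrow> 'x \<Rightarrow> real ^ 'p" where
  "posterior_mean \<Theta> f \<pi> n a x =
     (\<chi> j. LINT \<theta>:\<Theta>|lborel. \<theta> $ j * posterior_density \<Theta> f \<pi> n a x \<theta>)"

text \<open>
  Properness means that the normalising integral converges and is positive; integrability includes
  measurability of the unnormalised density in \<open>\<theta>\<close>.
\<close>

definition proper_posteriors ::
    "(nat \<Rightarrow> 'x measure) \<Rightarrow> (real ^ 'p) set \<Rightarrow> (nat \<Rightarrow> real ^ 'p \<Rightarrow> 'x \<Rightarrow> real) \<Rightarrow>
     (real ^ 'p \<Rightarrow> real) \<Rightarrow> (nat \<Rightarrow> 'x \<Rightarrow> real) \<Rightarrow> bool" where
  "proper_posteriors P \<Theta> f \<pi> a \<longleftrightarrow> (\<forall>n\<ge>1. AE x in P n.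
     set_integrable lborel \<Theta> (\<lambda>\<theta>. f n \<theta> x powr a n x * \<pi> \<theta>) \<and>
     0 < (LINT \<theta>:\<Theta>|lborel. f n \<theta> x powr a n x * \<pi> \<theta>))"

section \<open>Assumptions\<close>

text \<open>The normal law of \<open>m + A Z\<close>, where \<open>Z\<close> has independent standard normal coordinates; its
  covariance matrix is \<open>A ** transpose A\<close>.\<close>

definition normal_law :: "real ^ 'p \<Rightarrow> real ^ 'p ^ 'p \<Rightarrow> (real ^ 'p) measure" where
  "normal_law m A =
     distr (PiM UNIV (\<lambda>_. density lborel std_normal_density)) borel (\<lambda>z. m + A *v (\<chi> i. z i))"

definition conv_in_distr ::
    "(nat \<Rightarrow> 'a measure) \<Rightarrow> (nat \<Rightarrow> 'a \<Rightarrow> 'b::topological_space) \<Rightarrow> 'b measure \<Rightarrow> bool" where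
  "conv_in_distr P Z N \<longleftrightarrow> (\<forall>g :: 'b \<Rightarrow> real. continuous_on UNIV g \<and> bounded (range g) \<longrightarrow>
     (\<lambda>n. LINT x|P n. g (Z n x)) \<longlonglongrightarrow> (LINT z|N. g z))"

definition asymptotically_normal ::
    "(nat \<Rightarrow> 'a measure) \<Rightarrow> (nat \<Rightarrow> 'a \<Rightarrow> real ^ 'p) \<Rightarrow> bool" where
  "asymptotically_normal P Z \<longleftrightarrow> (\<exists>m A. conv_in_distr P Z (normal_law m A))"

definition unique_MLE ::
    "(real ^ 'p) set \<Rightarrow> (nat \<Rightarrow> real ^ 'p \<Rightarrow> 'x \<Rightarrow> real) \<Rightarrow> nat \<Rightarrow> 'x \<Rightarrow> real ^ 'p \<Rightarrow> bool" where
  "unique_MLE \<Theta> f n x t \<longleftrightarrow>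
     (\<forall>\<theta>. is_arg_max (\<lambda>\<theta>. f n \<theta> x) (\<lambda>\<theta>. \<theta> \<in> \<Theta>) \<theta> \<longleftrightarrow> \<theta> = t)"

definition A0 ::
    "(nat \<Rightarrow> 'x measure) \<Rightarrow> (real ^ 'p) set \<Rightarrow> (nat \<Rightarrow> real ^ 'p \<Rightarrow> 'x \<Rightarrow> real) \<Rightarrow>
     (nat \<Rightarrow> 'x \<Rightarrow> real ^ 'p) \<Rightarrow> real ^ 'p \<Rightarrow> bool" where
  "A0 P \<Theta> f \<theta>h \<theta>s \<longleftrightarrow>
     (\<forall>n\<ge>1. \<theta>h n \<in> borel_measurable (P n) \<and> (AE x in P n. unique_MLE \<Theta> f n x (\<theta>h n x))) \<and>
     open \<Theta> \<and> \<theta>s \<in> \<Theta> \<and> conv_in_prob P \<theta>h \<theta>s \<and>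
     asymptotically_normal P (\<lambda>n x. sqrt (real n) *\<^sub>R (\<theta>h n x - \<theta>s))"

definition twice_cont_diff_on :: "(real ^ 'p) set \<Rightarrow> (real ^ 'p \<Rightarrow> real) \<Rightarrow> bool" where
  "twice_cont_diff_on U g \<longleftrightarrow> (\<exists>(D :: real ^ 'p \<Rightarrow> real ^ 'p) (D2 :: real ^ 'p \<Rightarrow> real ^ 'p ^ 'p).
     (\<forall>\<theta>\<in>U. (g has_derivative (\<lambda>v. D \<theta> \<bullet> v)) (at \<theta>)) \<and>
     (\<forall>\<theta>\<in>U. (D has_derivative (\<lambda>v. D2 \<theta> *v v)) (at \<theta>)) \<and>
     continuous_on U D2)"

definition A1' :: "(real ^ 'p) set \<Rightarrow> (real ^ 'p \<Rightarrow> real) \<Rightarrow> real ^ 'p \<Rightarrow> bool" where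
  "A1' \<Theta> \<pi> \<theta>s \<longleftrightarrow>
     (\<exists>r>0. ball \<theta>s r \<subseteq> \<Theta> \<and> (\<forall>\<theta>\<in>ball \<theta>s r. 0 < \<pi> \<theta>) \<and> twice_cont_diff_on (ball \<theta>s r) \<pi>) \<and>
     set_integrable lborel \<Theta> (\<lambda>\<theta>. \<pi> \<theta> *\<^sub>R \<theta>)"

text \<open>
  Extended-real log-likelihood, since \<open>ln 0 = 0\<close> for reals.  The likelihood vanishes outside \<open>\<Theta>\<close>.
\<close>

definition loglik ::
    "(real ^ 'p) set \<Rightarrow> (nat \<Rightarrow> real ^ 'p \<Rightarrow> 'x \<Rightarrow> real) \<Rightarrow> nat \<Rightarrow> 'x \<Rightarrow> real ^ 'p \<Rightarrow> ereal" where
  "loglik \<Theta> f n x \<theta> = (if \<theta> \<in> \<Theta> \<and> 0 < f n \<theta> x then ereal (ln (f n \<theta> x)) else -\<infinity>)"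

definition cubic_form :: "('p \<Rightarrow> 'p \<Rightarrow> 'p \<Rightarrow> real) \<Rightarrow> real ^ 'p \<Rightarrow> real" where
  "cubic_form S h = (\<Sum>i\<in>UNIV. \<Sum>j\<in>UNIV. \<Sum>k\<in>UNIV. S i j k * h $ i * h $ j * h $ k)"

definition sym_pos_def :: "real ^ 'p ^ 'p \<Rightarrow> bool" where
  "sym_pos_def H \<longleftrightarrow> transpose H = H \<and> (\<forall>v. v \<noteq> 0 \<longrightarrow> 0 < v \<bullet> (H *v v))"

definition remainder ::
    "(real ^ 'p) set \<Rightarrow> (nat \<Rightarrow> real ^ 'p \<Rightarrow> 'x \<Rightarrow> real) \<Rightarrow> (nat \<Rightarrow> 'x \<Rightarrow> real ^ 'p) \<Rightarrow>
     (nat \<Rightarrow> real) \<Rightarrow> real ^ 'p ^ 'p \<Rightarrow> ('p \<Rightarrow> 'p \<Rightarrow> 'p \<Rightarrow> real) \<Rightarrow>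
     nat \<Rightarrow> 'x \<Rightarrow> real ^ 'p \<Rightarrow> ereal" where
  "remainder \<Theta> f \<theta>h \<alpha> H S n x h =
     ereal (\<alpha> n) * (loglik \<Theta> f n x (\<theta>h n x + h /\<^sub>R sqrt (\<alpha> n * real n)) - loglik \<Theta> f n x (\<theta>h n x))
     + ereal (1 / 2 * (h \<bullet> (H *v h)))
     - ereal (1 / (6 * sqrt (\<alpha> n * real n)) * cubic_form S h)"

text \<open>
  Positive definiteness of \<open>H n\<close> with probability tending to one has to be understood as
  asymptotic nondegeneracy: \<open>H n\<close> and its inverse are bounded in probability.  If \<open>H n\<close> were
  merely positive definite for each \<open>n\<close>, its eigenvalues could drift to 0 or to infinity and the
  posterior mean would not converge at the rate \<open>1 / (\<alpha> n * n)\<close>.  For instance, in dimension one,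
  \<open>ln (f n \<theta> x) = ln (f n (\<theta>h n x) x) - n * (t ^ 2 / 2 ^ Suc n + t ^ 4)\<close> with
  \<open>t = \<theta> - \<theta>h n x\<close> fulfils the expansion with \<open>H n = 1 / 2 ^ n\<close> and \<open>S n = 0\<close>, but the bias caused
  by a nonflat prior is of order \<open>1 / sqrt (\<alpha> n * n)\<close>.
\<close>

definition A2' ::
    "(nat \<Rightarrow> 'x measure) \<Rightarrow> (real ^ 'p) set \<Rightarrow> (nat \<Rightarrow> real ^ 'p \<Rightarrow> 'x \<Rightarrow> real) \<Rightarrow>
     (nat \<Rightarrow> 'x \<Rightarrow> real ^ 'p) \<Rightarrow> (nat \<Rightarrow> real) \<Rightarrow> bool" where
  "A2' P \<Theta> f \<theta>h \<alpha> \<longleftrightarrow>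
     (\<exists>(H :: nat \<Rightarrow> 'x \<Rightarrow> real ^ 'p ^ 'p) (S :: nat \<Rightarrow> 'x \<Rightarrow> 'p \<Rightarrow> 'p \<Rightarrow> 'p \<Rightarrow> real) (M :: real).
        (\<lambda>n. pr (P n) (\<lambda>x. \<not> sym_pos_def (H n x))) \<longlonglongrightarrow> 0 \<and>
        O_prob P H (\<lambda>_. 1) \<and> O_prob P (\<lambda>n x. matrix_inv (H n x)) (\<lambda>_. 1) \<and>
        (\<forall>\<epsilon>>0. \<exists>\<delta>>0. \<forall>\<^sub>F n in sequentially.
           pr (P n) (\<lambda>x.
             (SUP h\<in>{h. norm h / sqrt (\<alpha> n * real n) \<le> \<delta>}.
                \<bar>remainder \<Theta> f \<theta>h \<alpha> (H n x) (S n x) n x h\<bar>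
                - ereal (M / (\<alpha> n * real n) * norm h ^ 4)) > 0)
           < ennreal \<epsilon>))"

definition A3' ::
    "(nat \<Rightarrow> 'x measure) \<Rightarrow> (real ^ 'p) set \<Rightarrow> (nat \<Rightarrow> real ^ 'p \<Rightarrow> 'x \<Rightarrow> real) \<Rightarrow>
     (nat \<Rightarrow> 'x \<Rightarrow> real ^ 'p) \<Rightarrow> bool" where
  "A3' P \<Theta> f \<theta>h \<longleftrightarrow>
     (\<forall>\<epsilon>>0. \<forall>\<delta>'>0. \<exists>c>0. \<forall>\<^sub>F n in sequentially.
        pr (P n) (\<lambda>x.
          (SUP \<theta>\<in>- ball (\<theta>h n x) \<delta>'.
             ereal (1 / real n) * loglik \<Theta> f n x \<theta>
             - ereal (1 / real n) * loglik \<Theta> f n x (\<theta>h n x)) > ereal (- c))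
        < ennreal \<epsilon>)"

end

theory Submission
  imports Defs
begin

text \<open>
  Fix a sample, write \<open>m\<close> for the MLE, \<open>t = \<theta> - m\<close>, and let \<open>N = a n\<close> for the exponent \<open>a\<close> of the
  tempered likelihood.  Dividing the tempered likelihood by its value at \<open>m\<close>, the error of the
  posterior mean is the quotient of \<open>\<integral> \<phi> W t\<close> by \<open>\<integral> \<phi> W\<close>, where \<open>W\<close> is the prior and
  \<open>\<phi> = exp (- N (t \<bullet> H t) / 2 + u)\<close> near \<open>m\<close> with \<open>|u| \<le> N K |t|\<^sup>3\<close>.  The leading part of the
  numerator, \<open>W m \<integral> exp (- N (t \<bullet> H t) / 2) t\<close>, vanishes because the integrand is odd.  What is left
  contains either the factor \<open>u\<close> or the prior increment \<open>W \<theta> - W m\<close>, which is at most \<open>L |t|\<close>;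
  together with the factor \<open>t\<close> this leaves Gaussian integrals of \<open>N |t|\<^sup>4\<close> and \<open>|t|\<^sup>2\<close>, and both are
  of order \<open>1 / N\<close> relative to the denominator.  The part of the numerator away from \<open>m\<close> is
  exponentially small in \<open>N\<close>.  With the localisation scale \<open>s = 1 / sqrt N\<close> this is the Laplace
  estimate of the locale \<open>peaked_weight\<close>, whose conclusion is \<open>first_moment_le_mass\<close>.

  Since only the size of \<open>u\<close> enters, the cubic tensor matters only through a bound, and that bound
  comes from maximality: the log-likelihood ratio is at most 0 at both \<open>t\<close> and \<open>- t\<close>, whereas the
  cubic term changes sign (\<open>cubic_term_absorbed\<close>).  The bounds on \<open>H\<close> and its inverse bound the
  quadratic form from both sides (\<open>sym_pos_def_lower_bound\<close>).

  All these constants can be chosen from a prescribed error probability, uniformly in \<open>n\<close>, so that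
  the requirements (\<open>regular_sample\<close>) hold outside finitely many events of small outer
  probability.  The deterministic bound \<open>regular_sample_bias\<close> has the form \<open>C / (a n)\<close> for every
  exponent \<open>a\<close>, so a data-dependent exponent can be plugged in for each sample; the requirement
  that it be comparable to \<open>\<alpha> n\<close> is one more event.  The deterministic exponent is the special case
  of a constant one.
\<close>

section \<open>Outer probabilities\<close>

lemma pr_mono:
  assumes "\<And>x. x \<in> space M \<Longrightarrow> E x \<Longrightarrow> F x"
  shows "pr M E \<le> pr M F"
  unfolding pr_def by (rule outer_measure_of_mono) (use assms in auto)

text \<open>
  The events need not be measurable, so the union bound goes through measurable hulls of the same
  outer measure.
\<close>

lemma pr_disj_le: "pr M (\<lambda>x. E x \<or> F x) \<le> pr M E + pr M F"
proof -
  obtain A where A: "A \<in> sets M" "{x\<in>space M. E x} \<subseteq> A" "pr M E = emeasure M A"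
    using outer_measure_of_attain[of "{x\<in>space M. E x}" M] unfolding pr_def by blast
  obtain B where B: "B \<in> sets M" "{x\<in>space M. F x} \<subseteq> B" "pr M F = emeasure M B"
    using outer_measure_of_attain[of "{x\<in>space M. F x}" M] unfolding pr_def by blast
  have "pr M (\<lambda>x. E x \<or> F x) \<le> outer_measure_of M (A \<union> B)"
    unfolding pr_def by (rule outer_measure_of_mono) (use A B in auto)
  also have "\<dots> = emeasure M (A \<union> B)"
    using A B by simp
  also have "\<dots> \<le> pr M E + pr M F"
    using A B by (simp add: emeasure_subadditive)
  finally show ?thesis .
qed

lemma pr_eq_0_if_AE:
  assumes "AE x in M. E x"
  shows "pr M (\<lambda>x. \<not> E x) = 0"
proof -
  obtain N where N: "N \<in> sets M" "emeasure M N = 0" "{x\<in>space M. \<not> E x} \<subseteq> N"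
    using AE_E[OF assms] by metis
  have "pr M (\<lambda>x. \<not> E x) \<le> outer_measure_of M N"
    unfolding pr_def by (rule outer_measure_of_mono) (rule N)
  then show ?thesis using N by simp
qed

lemma pr_disj_less:
  assumes "pr M E < ennreal a" and "pr M F < ennreal b"
  shows "pr M (\<lambda>x. E x \<or> F x) < ennreal (a + b)"
proof -
  obtain p where p: "0 \<le> p" "pr M E = ennreal p"
    using assms(1) by (cases "pr M E") auto
  obtain q where q: "0 \<le> q" "pr M F = ennreal q"
    using assms(2) by (cases "pr M F") auto
  have "pr M (\<lambda>x. E x \<or> F x) \<le> ennreal (p + q)"
    using pr_disj_le[of M E F] p q by (simp add: ennreal_plus)
  also have "\<dots> < ennreal (a + b)"
    using assms p q by (intro ennreal_lessI) (auto simp: ennreal_less_iff)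
  finally show ?thesis .
qed

lemma conv_in_probD:
  assumes "conv_in_prob P Y c" and "0 < d" and "0 < e"
  shows "\<forall>\<^sub>F n in sequentially. pr (P n) (\<lambda>x. dist (Y n x) c > d) < ennreal e"
  using assms unfolding conv_in_prob_def by (intro order_tendstoD(2)[of _ 0]) simp_all

section \<open>Quadratic forms of matrices\<close>

lemma norm_matrix_vector_mult_le:
  fixes A :: "real ^ 'n ^ 'm"
  shows "norm (A *v v) \<le> norm A * norm v"
proof -
  have "norm (A *v v) \<le> L2_set (\<lambda>i. norm (A $ i) * norm v) UNIV"
    unfolding norm_vec_def[of "A *v v"]
    by (rule L2_set_mono)
       (auto simp: matrix_vector_mul_component Cauchy_Schwarz_ineq2)
  also have "\<dots> = norm A * norm v"
    by (simp add: norm_vec_def[of A] L2_set_left_distrib)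
  finally show ?thesis .
qed

text \<open>
  The smallest eigenvalue is bounded below by the inverse of the norm of the inverse.  This follows
  without spectral theory by evaluating the form at \<open>v - w / b\<close>, where \<open>w\<close> solves \<open>H w = v\<close>:
  the result \<open>v \<bullet> H v - 2 |v|\<^sup>2 / b + (w \<bullet> v) / b\<^sup>2\<close> is nonnegative, and \<open>w \<bullet> v \<le> b |v|\<^sup>2\<close>.
\<close>

lemma sym_pos_def_lower_bound:
  fixes H :: "real ^ 'p ^ 'p"
  assumes "sym_pos_def H" and "norm (matrix_inv H) \<le> b" and "0 < b"
  shows "(norm v)\<^sup>2 / b \<le> v \<bullet> (H *v v)"
proof -
  have sym: "transpose H = H" and pos: "\<And>v. v \<noteq> 0 \<Longrightarrow> 0 < v \<bullet> (H *v v)"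
    using assms(1) by (auto simp: sym_pos_def_def)
  have ker: "x = 0" if "H *v x = 0" for x
    using pos[of x] that by (cases "x = 0") auto
  obtain B where "B ** H = mat 1" using ker matrix_left_invertible_ker by blast
  then have "invertible H" using invertible_left_inverse by blast
  then have inv: "H ** matrix_inv H = mat 1"
    unfolding invertible_def matrix_inv_def by (rule someI2_ex) blast
  define w where "w = matrix_inv H *v v"
  have Hw: "H *v w = v" by (simp add: w_def matrix_vector_mul_assoc inv)
  have "norm w \<le> b * norm v"
    unfolding w_def by (rule order_trans[OF norm_matrix_vector_mult_le]) (simp add: assms mult_right_mono)
  then have "w \<bullet> v \<le> b * norm v * norm v"
    using norm_cauchy_schwarz[of w v] by (meson mult_right_mono norm_ge_zero order_trans)
  then have wv: "w \<bullet> v \<le> b * (norm v)\<^sup>2" by (simp add: power2_eq_square mult.assoc)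
  have symm: "w \<bullet> (H *v v) = v \<bullet> v"
    using dot_lmul_matrix[of w H v] Hw sym by (metis transpose_matrix_vector)
  define u where "u = v - (1 / b) *\<^sub>R w"
  have "0 \<le> u \<bullet> (H *v u)" using pos[of u] by (cases "u = 0") auto
  also have "H *v u = H *v v - (1 / b) *\<^sub>R v"
    by (simp add: u_def matrix_vector_mult_diff_distrib Hw matrix_vector_mult_scaleR)
  also have "u \<bullet> (H *v v - (1 / b) *\<^sub>R v)
      = v \<bullet> (H *v v) - 2 * (1 / b) * (v \<bullet> v) + (1 / b)\<^sup>2 * (w \<bullet> v)"
    by (simp add: u_def inner_diff_left inner_diff_right symm algebra_simps power2_eq_square)
  also have "(1 / b)\<^sup>2 * (w \<bullet> v) \<le> (1 / b)\<^sup>2 * (b * (norm v)\<^sup>2)"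
    by (rule mult_left_mono[OF wv]) simp
  also have "\<dots> = (norm v)\<^sup>2 / b" using assms(3) by (simp add: power2_eq_square)
  finally show ?thesis
    by (simp add: power2_norm_eq_inner)
qed

lemma borel_measurable_quadratic_form:
  "(\<lambda>t :: real ^ 'p. t \<bullet> (H *v t)) \<in> borel_measurable borel"
  by (intro borel_measurable_continuous_onI continuous_intros)

section \<open>Gaussian moments\<close>

lemma integral_lborel_affine:
  fixes g :: "'a::euclidean_space \<Rightarrow> 'b::{banach, second_countable_topology}"
  assumes [measurable]: "g \<in> borel_measurable borel" and "c \<noteq> 0"
  shows "integral\<^sup>L lborel g = \<bar>c\<bar> ^ DIM('a) *\<^sub>R (LINT y|lborel. g (m + c *\<^sub>R y))"
proof -
  have "integral\<^sup>L lborel g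
      = integral\<^sup>L (density (distr lborel borel (\<lambda>x. m + c *\<^sub>R x)) (\<lambda>_. \<bar>c\<bar> ^ DIM('a))) g"
    using lborel_affine[OF assms(2), of m] by (rule arg_cong[where f = "\<lambda>M. integral\<^sup>L M g"])
  also have "\<dots> = (LINT x|distr lborel borel (\<lambda>x. m + c *\<^sub>R x). \<bar>c\<bar> ^ DIM('a) *\<^sub>R g x)"
    by (rule integral_density) auto
  also have "\<dots> = (LINT y|lborel. \<bar>c\<bar> ^ DIM('a) *\<^sub>R g (m + c *\<^sub>R y))"
    by (rule integral_distr) auto
  finally show ?thesis by simp
qed

lemma integrable_lborel_affine:
  fixes g :: "'a::euclidean_space \<Rightarrow> 'b::{banach, second_countable_topology}"
  assumes [measurable]: "g \<in> borel_measurable borel"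
    and "c \<noteq> 0" and "integrable lborel (\<lambda>y. g (m + c *\<^sub>R y))"
  shows "integrable lborel g"
proof -
  have "integrable (distr lborel borel (\<lambda>x. m + c *\<^sub>R x)) (\<lambda>x. \<bar>c\<bar> ^ DIM('a) *\<^sub>R g x)"
    by (subst integrable_distr_eq) (use assms(3) in auto)
  then have "integrable (density (distr lborel borel (\<lambda>x. m + c *\<^sub>R x)) (\<lambda>_. \<bar>c\<bar> ^ DIM('a))) g"
    by (subst integrable_density) auto
  then show ?thesis by (simp only: lborel_affine[OF assms(2), of m, symmetric])
qed

lemma integral_odd_eq_0:
  fixes g :: "'a::euclidean_space \<Rightarrow> 'b::{banach, second_countable_topology}"
  assumes "g \<in> borel_measurable borel" and "\<And>t. g (m - t) = - g (m + t)"
  shows "integral\<^sup>L lborel g = 0"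
proof -
  have "integral\<^sup>L lborel g = (LINT y|lborel. g (m + y))"
    using integral_lborel_affine[OF assms(1), of 1 m] by simp
  moreover have "integral\<^sup>L lborel g = - (LINT y|lborel. g (m + y))"
    using integral_lborel_affine[OF assms(1), of "-1" m] assms(2) by simp
  ultimately have "2 *\<^sub>R integral\<^sup>L lborel g = 0"
    unfolding scaleR_2 using add.right_inverse by metis
  then show ?thesis by simp
qed

lemma integrable_gaussian:
  assumes "0 < \<kappa>"
  shows "integrable lborel (\<lambda>y :: 'a::euclidean_space. exp (- \<kappa> * (norm y)\<^sup>2))"
proof (rule integrableI_nonneg)
  have 1: "integrable lborel (\<lambda>x :: real. exp (- \<kappa> * x\<^sup>2))"
  proof -
    \<comment> \<open>with this standard deviation the normal density is a multiple of the integrand\<close>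
    define \<sigma> where "\<sigma> = sqrt (1 / (2 * \<kappa>))"
    have "0 < \<sigma>" using assms by (simp add: \<sigma>_def)
    have "\<sigma>\<^sup>2 = 1 / (2 * \<kappa>)" using assms by (simp add: \<sigma>_def)
    then have "exp (- \<kappa> * x\<^sup>2) = sqrt (2 * pi * \<sigma>\<^sup>2) * normal_density 0 \<sigma> x" for x
      using assms \<open>0 < \<sigma>\<close> by (simp add: normal_density_def field_simps)
    moreover have "integrable lborel (\<lambda>x. sqrt (2 * pi * \<sigma>\<^sup>2) * normal_density 0 \<sigma> x)"
      by (intro integrable_mult_right integrable_normal_density)
         (use assms in \<open>simp_all add: \<sigma>_def\<close>)
    ultimately show ?thesis by simp
  qed
  have "(\<integral>\<^sup>+ (y :: 'a). ennreal (exp (- \<kappa> * (norm y)\<^sup>2)) \<partial>lborel)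
      = (\<integral>\<^sup>+ (y :: 'a). ennreal (\<Prod>b\<in>Basis. exp (- \<kappa> * (y \<bullet> b)\<^sup>2)) \<partial>lborel)"
  proof (rule nn_integral_cong)
    fix y :: 'a
    have "(norm y)\<^sup>2 = (\<Sum>b\<in>Basis. (y \<bullet> b)\<^sup>2)"
      unfolding power2_norm_eq_inner by (subst euclidean_inner) (simp add: power2_eq_square)
    then show "ennreal (exp (- \<kappa> * (norm y)\<^sup>2)) = ennreal (\<Prod>b\<in>Basis. exp (- \<kappa> * (y \<bullet> b)\<^sup>2))"
      by (simp only: sum_distrib_left exp_sum[OF finite_Basis])
  qed
  also have "\<dots> = (\<integral>\<^sup>+ (y :: 'a). (\<Prod>b\<in>Basis. ennreal (exp (- \<kappa> * (y \<bullet> b)\<^sup>2))) \<partial>lborel)"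
    by (simp add: prod_ennreal)
  also have "\<dots> = (\<Prod>b\<in>(Basis :: 'a set). (\<integral>\<^sup>+ x. ennreal (exp (- \<kappa> * x\<^sup>2)) \<partial>lborel))"
    by (rule nn_integral_lborel_prod[where f = "\<lambda>_ x. ennreal (exp (- \<kappa> * x\<^sup>2))"]) auto
  also have "\<dots> < \<infinity>"
    using 1 by (simp add: power_less_top_ennreal integrable_iff_bounded)
  finally show "(\<integral>\<^sup>+ (y :: 'a). ennreal (exp (- \<kappa> * (norm y)\<^sup>2)) \<partial>lborel) < \<infinity>" .
qed auto

lemma power_le_fact_mult_exp:
  fixes x :: real
  assumes "0 \<le> x"
  shows "x ^ k \<le> fact k * exp x"
proof -
  have "(\<Sum>i\<in>{k}. x ^ i /\<^sub>R fact i) \<le> (\<Sum>i. x ^ i /\<^sub>R fact i)"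
    by (rule sum_le_suminf) (use assms summable_exp_generic[of x] in auto)
  then show ?thesis by (simp add: exp_def field_simps)
qed

definition gaussian_moment :: "'a::euclidean_space itself \<Rightarrow> nat \<Rightarrow> real \<Rightarrow> real" where
  "gaussian_moment _ k \<kappa> = (LINT (y::'a)|lborel. norm y ^ k * exp (- \<kappa> * (norm y)\<^sup>2))"

lemma gaussian_moment_nonneg: "0 \<le> gaussian_moment TYPE('a::euclidean_space) k \<kappa>"
  unfolding gaussian_moment_def by (rule integral_nonneg_AE) simp

text \<open>
  A power of \<open>(norm y)\<^sup>2\<close> is absorbed by half of the exponent.
\<close>

lemma integrable_norm_power_gaussian:
  assumes "0 < \<kappa>" and "even k"
  shows "integrable lborel (\<lambda>y :: 'a::euclidean_space. norm y ^ k * exp (- \<kappa> * (norm y)\<^sup>2))"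
proof -
  obtain j where j: "k = 2 * j" using assms(2) by blast
  define C where "C = fact j / (\<kappa> / 2) ^ j"
  have bound: "norm y ^ k * exp (- \<kappa> * (norm y)\<^sup>2) \<le> C * exp (- (\<kappa> / 2) * (norm y)\<^sup>2)" for y :: 'a
  proof -
    have "(\<kappa> / 2 * (norm y)\<^sup>2) ^ j \<le> fact j * exp (\<kappa> / 2 * (norm y)\<^sup>2)"
      by (rule power_le_fact_mult_exp) (use assms in simp)
    then have "norm y ^ k * (\<kappa> / 2) ^ j \<le> fact j * exp (\<kappa> / 2 * (norm y)\<^sup>2)"
      unfolding j power_mult power_mult_distrib by (simp only: mult.commute)
    moreover have "0 < (\<kappa> / 2) ^ j" using assms by simp
    ultimately have "norm y ^ k \<le> C * exp (\<kappa> / 2 * (norm y)\<^sup>2)"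
      unfolding C_def times_divide_eq_left by (subst pos_le_divide_eq)
    then have "norm y ^ k * exp (- \<kappa> * (norm y)\<^sup>2)
        \<le> C * exp (\<kappa> / 2 * (norm y)\<^sup>2) * exp (- \<kappa> * (norm y)\<^sup>2)"
      by (rule mult_right_mono) simp
    then show ?thesis by (simp add: mult.assoc flip: exp_add)
  qed
  have "integrable lborel (\<lambda>y :: 'a. C * exp (- (\<kappa> / 2) * (norm y)\<^sup>2))"
    using assms by (intro integrable_mult_right integrable_gaussian) simp
  then show ?thesis
    by (rule Bochner_Integration.integrable_bound) (use order_trans[OF bound abs_ge_self] in auto)
qed

text \<open>
  Each factor of \<open>norm (\<theta> - m)\<close> is worth one power of the scale \<open>s\<close>; the common factor
  \<open>s ^ DIM('a)\<close> from the volume element also appears in the mass and cancels in the quotient.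
\<close>

lemma scaled_gaussian_moment:
  fixes m :: "'a::euclidean_space"
  assumes "0 < s" and "0 < \<kappa>" and "even k"
  defines "g \<equiv> \<lambda>\<theta>. norm (\<theta> - m) ^ k * exp (- \<kappa> * (norm (\<theta> - m))\<^sup>2 / s\<^sup>2)"
  shows "integrable lborel g"
    and "integral\<^sup>L lborel g = s ^ (DIM('a) + k) * gaussian_moment TYPE('a) k \<kappa>"
proof -
  have [measurable]: "g \<in> borel_measurable borel" unfolding g_def by measurable
  have g: "g (m + s *\<^sub>R y) = s ^ k * (norm y ^ k * exp (- \<kappa> * (norm y)\<^sup>2))" for y
    using assms(1) by (simp add: g_def power_mult_distrib)
  show "integrable lborel g"
    by (rule integrable_lborel_affine[where c = s and m = m])
       (use assms(1) integrable_norm_power_gaussian[OF assms(2,3)] in \<open>auto simp: g\<close>)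
  show "integral\<^sup>L lborel g = s ^ (DIM('a) + k) * gaussian_moment TYPE('a) k \<kappa>"
    using assms(1)
    by (subst integral_lborel_affine[where c = s and m = m])
       (simp_all add: g gaussian_moment_def power_add)
qed

section \<open>Laplace estimate for the first moment of a peaked weight\<close>

lemma abs_exp_minus_1_le: "\<bar>exp u - 1\<bar> \<le> \<bar>u\<bar> * exp \<bar>u\<bar>" for u :: real
proof (cases "0 \<le> u")
  case True
  have "exp u * (1 - u) \<le> exp u * exp (- u)"
    using exp_ge_add_one_self[of "- u"] by (intro mult_left_mono) auto
  then show ?thesis using True by (simp add: algebra_simps flip: exp_add)
next
  case False
  have "1 + u \<le> exp u" by (rule exp_ge_add_one_self)
  moreover have "- u * 1 \<le> - u * exp (- u)"
    using False by (intro mult_left_mono) auto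
  moreover have "\<bar>exp u - 1\<bar> = 1 - exp u" "\<bar>u\<bar> = - u" using False by auto
  ultimately show ?thesis by (simp only:)
qed

text \<open>
  With \<open>\<phi> = exp (- q / s\<^sup>2 + u)\<close>, the product \<open>\<phi> w\<close> differs from \<open>w0 exp (- q / s\<^sup>2)\<close> through \<open>w - w0\<close>
  and through \<open>exp u - 1\<close>.  Both differences are small, and the factor \<open>exp |u|\<close> that they bring in
  costs half of the quadratic exponent, since \<open>K x \<le> \<kappa>\<close> makes \<open>|u|\<close> at most \<open>\<kappa> x\<^sup>2 / s\<^sup>2\<close>.  The
  additional factor \<open>x\<close> on the left is the one from the integrand of a first moment.
\<close>

lemma perturbed_gaussian_error:
  fixes x q u s :: real
  assumes "0 < s" and "0 \<le> x" and "0 < \<phi>" and "2 * \<kappa> * x\<^sup>2 \<le> q"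
    and u: "\<bar>ln \<phi> + q / s\<^sup>2\<bar> \<le> K * x ^ 3 / s\<^sup>2"
    and "K * x \<le> \<kappa>" and "\<bar>w - w0\<bar> \<le> L * x" and "0 \<le> w0" and "w0 \<le> p1" and "0 \<le> L"
  shows "\<bar>\<phi> * w - w0 * exp (- q / s\<^sup>2)\<bar> * x
    \<le> (p1 * K / s\<^sup>2 * x ^ 4 + L * x\<^sup>2) * exp (- \<kappa> * x\<^sup>2 / s\<^sup>2)"
proof -
  define u where "u = ln \<phi> + q / s\<^sup>2"
  have u_le: "\<bar>u\<bar> \<le> K * x ^ 3 / s\<^sup>2" using assms(5) by (simp add: u_def)
  have "K * x ^ 3 \<le> \<kappa> * x\<^sup>2"
    using mult_right_mono[OF assms(6), of "x\<^sup>2"] by (simp add: power2_eq_square power3_eq_cube mult.assoc)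
  then have "K * x ^ 3 / s\<^sup>2 \<le> \<kappa> * x\<^sup>2 / s\<^sup>2"
    by (rule divide_right_mono) simp
  moreover have "2 * (\<kappa> * x\<^sup>2 / s\<^sup>2) \<le> q / s\<^sup>2"
    using divide_right_mono[OF assms(4), of "s\<^sup>2"] by simp
  ultimately have expo: "- q / s\<^sup>2 + \<bar>u\<bar> \<le> - \<kappa> * x\<^sup>2 / s\<^sup>2" using u_le by simp
  have phi: "\<phi> = exp (- q / s\<^sup>2) * exp u"
    using assms(3) by (simp add: u_def flip: exp_add)
  have "\<phi> * w - w0 * exp (- q / s\<^sup>2) = exp (- q / s\<^sup>2) * (exp u * (w - w0) + w0 * (exp u - 1))"
    by (simp add: phi algebra_simps)
  moreover have "\<bar>exp u * (w - w0) + w0 * (exp u - 1)\<bar> \<le> exp \<bar>u\<bar> * (L * x + p1 * \<bar>u\<bar>)"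
  proof -
    have "\<bar>exp u * (w - w0)\<bar> \<le> exp \<bar>u\<bar> * (L * x)"
      unfolding abs_mult using assms(7) by (intro mult_mono) auto
    moreover have "\<bar>w0 * (exp u - 1)\<bar> \<le> p1 * (\<bar>u\<bar> * exp \<bar>u\<bar>)"
      unfolding abs_mult using assms(8,9) abs_exp_minus_1_le[of u] by (intro mult_mono) auto
    ultimately show ?thesis by (simp add: algebra_simps)
  qed
  ultimately have "\<bar>\<phi> * w - w0 * exp (- q / s\<^sup>2)\<bar>
      \<le> exp (- q / s\<^sup>2) * (exp \<bar>u\<bar> * (L * x + p1 * \<bar>u\<bar>))"
    by (simp add: abs_mult)
  also have "\<dots> = exp (- q / s\<^sup>2 + \<bar>u\<bar>) * (L * x + p1 * \<bar>u\<bar>)"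
    by (simp only: exp_add mult.assoc)
  also have "\<dots> \<le> exp (- \<kappa> * x\<^sup>2 / s\<^sup>2) * (L * x + p1 * (K * x ^ 3 / s\<^sup>2))"
    using expo u_le assms(2,8-10) by (intro mult_mono add_mono) auto
  finally have "\<bar>\<phi> * w - w0 * exp (- q / s\<^sup>2)\<bar> * x
      \<le> exp (- \<kappa> * x\<^sup>2 / s\<^sup>2) * (L * x + p1 * (K * x ^ 3 / s\<^sup>2)) * x"
    using assms(2) by (rule mult_right_mono)
  also have "\<dots> = (p1 * K / s\<^sup>2 * x ^ 4 + L * x\<^sup>2) * exp (- \<kappa> * x\<^sup>2 / s\<^sup>2)"
    by (simp add: algebra_simps power2_eq_square power3_eq_cube power4_eq_xxxx)
  finally show ?thesis .
qed

text \<open>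
  The function \<open>\<phi>\<close> plays the tempered likelihood ratio: it is close to a Gaussian of width \<open>s\<close> on the
  ball of radius \<open>\<delta>\<close> and exponentially small elsewhere.  The function \<open>W\<close> plays the prior, extended
  by zero.  The parameters declared before \<open>m\<close> stay fixed while \<open>m\<close>, \<open>s\<close>, \<open>Q\<close>, \<open>\<phi>\<close> and \<open>W\<close> vary
  from sample to sample, so the bounds below must be expressed in the former and in powers of \<open>s\<close>.
\<close>

locale peaked_weight =
  fixes \<kappa> \<Lambda> K \<delta> c p0 p1 L A :: real
    and m :: "'a::euclidean_space" and s :: real and Q \<phi> W :: "'a \<Rightarrow> real"
  assumes constants: "0 < \<kappa>" "0 \<le> K" "K * \<delta> \<le> \<kappa>" "0 < c" "0 < p0" "0 \<le> L"
    and scale: "0 < s" "s \<le> 1" "s \<le> \<delta>"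
    and Q_measurable [measurable]: "Q \<in> borel_measurable borel"
    and Q_even: "\<And>t. Q (- t) = Q t"
    and Q_lower: "\<And>t. 2 * \<kappa> * (norm t)\<^sup>2 \<le> Q t"
    and Q_upper: "\<And>t. Q t \<le> \<Lambda> * (norm t)\<^sup>2"
    and \<phi>_nonneg: "\<And>\<theta>. 0 \<le> \<phi> \<theta>"
    and \<phi>_pos: "\<And>\<theta>. \<theta> \<in> cball m \<delta> \<Longrightarrow> 0 < \<phi> \<theta>"
    and \<phi>_near: "\<And>\<theta>. \<theta> \<in> cball m \<delta> \<Longrightarrow>
      \<bar>ln (\<phi> \<theta>) + Q (\<theta> - m) / s\<^sup>2\<bar> \<le> K * norm (\<theta> - m) ^ 3 / s\<^sup>2"
    and \<phi>_far: "\<And>\<theta>. \<theta> \<notin> cball m \<delta> \<Longrightarrow> W \<theta> \<noteq> 0 \<Longrightarrow> \<phi> \<theta> \<le> exp (- c / s\<^sup>2)"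
    and W_nonneg: "\<And>\<theta>. 0 \<le> W \<theta>"
    and W_lower: "\<And>\<theta>. \<theta> \<in> cball m \<delta> \<Longrightarrow> p0 \<le> W \<theta>"
    and W_upper: "W m \<le> p1"
    and W_Lipschitz: "\<And>\<theta>. \<theta> \<in> cball m \<delta> \<Longrightarrow> \<bar>W \<theta> - W m\<bar> \<le> L * norm (\<theta> - m)"
    and W_moment: "integrable lborel (\<lambda>\<theta>. W \<theta> * norm (\<theta> - m))"
      "(LINT \<theta>|lborel. W \<theta> * norm (\<theta> - m)) \<le> A"
    and mass_integrable: "integrable lborel (\<lambda>\<theta>. \<phi> \<theta> * W \<theta>)"
    and moment_integrable: "integrable lborel (\<lambda>\<theta>. (\<phi> \<theta> * W \<theta>) *\<^sub>R (\<theta> - m))"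
begin

text \<open>
  On the ball of radius \<open>s\<close> the exponent is bounded, so the mass is at least of the order of the
  volume of this ball.
\<close>

lemma mass_lower:
  "p0 * exp (- (\<Lambda> + \<kappa>)) * (unit_ball_vol DIM('a) * s ^ DIM('a)) \<le> (LINT \<theta>|lborel. \<phi> \<theta> * W \<theta>)"
proof -
  have low: "p0 * exp (- (\<Lambda> + \<kappa>)) \<le> \<phi> \<theta> * W \<theta>" if "\<theta> \<in> cball m s" for \<theta>
  proof -
    define x where "x = norm (\<theta> - m)"
    have \<theta>: "\<theta> \<in> cball m \<delta>" and x: "0 \<le> x" "x \<le> s"
      using that scale(3) by (auto simp: x_def dist_norm norm_minus_commute)
    have "x\<^sup>2 \<le> s\<^sup>2" using x by (intro power_mono)
    then have x1: "x\<^sup>2 / s\<^sup>2 \<le> 1" using scale by simp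
    \<comment> \<open>compare the two bounds on \<open>Q\<close> at a unit vector\<close>
    have "0 \<le> \<Lambda>"
      using order_trans[OF Q_lower Q_upper, of "SOME b. b \<in> Basis"] constants(1)
      by (simp add: SOME_Basis)
    have "Q (\<theta> - m) / s\<^sup>2 \<le> \<Lambda> * (x\<^sup>2 / s\<^sup>2)"
      using divide_right_mono[OF Q_upper, of "s\<^sup>2" "\<theta> - m"] by (simp add: x_def)
    also have "\<dots> \<le> \<Lambda>" using mult_left_mono[OF x1 \<open>0 \<le> \<Lambda>\<close>] by simp
    finally have 1: "Q (\<theta> - m) / s\<^sup>2 \<le> \<Lambda>" .
    have "K * x \<le> \<kappa>" using x scale constants mult_left_mono[of x \<delta> K] by linarith
    then have "K * x * (x\<^sup>2 / s\<^sup>2) \<le> \<kappa> * 1"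
      using x1 x constants by (intro mult_mono) auto
    then have "K * x ^ 3 / s\<^sup>2 \<le> \<kappa>" by (simp add: power2_eq_square power3_eq_cube mult.assoc)
    then have "- (\<Lambda> + \<kappa>) \<le> ln (\<phi> \<theta>)" using \<phi>_near[OF \<theta>] 1 by (simp add: x_def abs_le_iff)
    then have "exp (- (\<Lambda> + \<kappa>)) \<le> \<phi> \<theta>" using \<phi>_pos[OF \<theta>] ln_ge_iff by blast
    then have "exp (- (\<Lambda> + \<kappa>)) * p0 \<le> \<phi> \<theta> * W \<theta>"
      using W_lower[OF \<theta>] constants \<phi>_nonneg by (intro mult_mono) auto
    then show ?thesis by (simp add: mult.commute)
  qed
  have fin: "emeasure lborel (cball m s) < \<infinity>"
by (rule emeasure_bounded_finite) simp
  have "p0 * exp (- (\<Lambda> + \<kappa>)) * measure lborel (cball m s)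
      = (LINT \<theta>|lborel. p0 * exp (- (\<Lambda> + \<kappa>)) * indicator (cball m s) \<theta>)"
    by simp
  also have "\<dots> \<le> (LINT \<theta>|lborel. \<phi> \<theta> * W \<theta>)"
  proof (rule integral_mono)
    show "integrable lborel (\<lambda>\<theta>. p0 * exp (- (\<Lambda> + \<kappa>)) * indicator (cball m s) \<theta>)"
      using fin by (intro integrable_mult_right integrable_real_indicator) auto
    show "p0 * exp (- (\<Lambda> + \<kappa>)) * indicator (cball m s) \<theta> \<le> \<phi> \<theta> * W \<theta>" for \<theta>
      using low[of \<theta>] \<phi>_nonneg[of \<theta>] W_nonneg[of \<theta>] by (cases "\<theta> \<in> cball m s") auto
  qed (rule mass_integrable)
  finally show ?thesis using content_cball[of s m] scale by simp
qed

text \<open>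
  The symmetry about \<open>m\<close> gains a factor \<open>s\<close> here: the integral of \<open>W m exp (- Q t / s\<^sup>2) t\<close> vanishes,
  and without it the order would be \<open>s ^ (DIM('a) + 1)\<close>.
\<close>

lemma first_moment_near:
  "norm (LINT \<theta>:cball m \<delta>|lborel. (\<phi> \<theta> * W \<theta>) *\<^sub>R (\<theta> - m))
    \<le> s ^ (DIM('a) + 2) * (p1 * K * gaussian_moment TYPE('a) 4 \<kappa> + L * gaussian_moment TYPE('a) 2 \<kappa>)"
proof -
  define D where "D = cball m \<delta>"
  have D [measurable]: "D \<in> sets borel" by (simp add: D_def)
  define E where "E \<theta> = \<phi> \<theta> * W \<theta> - W m * exp (- Q (\<theta> - m) / s\<^sup>2)" for \<theta>
  define odd_part where "odd_part \<theta> = indicator D \<theta> *\<^sub>R (exp (- Q (\<theta> - m) / s\<^sup>2) *\<^sub>R (\<theta> - m))" for \<theta>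
  define g where "g k \<theta> = norm (\<theta> - m) ^ k * exp (- \<kappa> * (norm (\<theta> - m))\<^sup>2 / s\<^sup>2)" for k :: nat and \<theta>
  have [measurable]: "odd_part \<in> borel_measurable borel" unfolding odd_part_def by measurable
  have odd_int: "integrable lborel odd_part"
  proof (rule Bochner_Integration.integrable_bound)
    have "emeasure lborel D < \<infinity>"
      unfolding D_def by (rule emeasure_bounded_finite) simp
    then show "integrable lborel (\<lambda>\<theta>. \<delta> * indicator D \<theta>)"
      by (intro integrable_mult_right integrable_real_indicator) auto
    have "norm (odd_part \<theta>) \<le> norm (\<delta> * indicator D \<theta>)" for \<theta>
    proof (cases "\<theta> \<in> D")
      case True
      have "0 \<le> Q (\<theta> - m)"
        by (rule order_trans[OF _ Q_lower]) (use constants(1) in simp)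
      then have "exp (- Q (\<theta> - m) / s\<^sup>2) * norm (\<theta> - m) \<le> 1 * \<delta>"
        using True by (intro mult_mono) (auto simp: D_def dist_norm norm_minus_commute)
      then show ?thesis using True by (simp add: odd_part_def)
    qed (simp add: odd_part_def)
    then show "AE \<theta> in lborel. norm (odd_part \<theta>) \<le> norm (\<delta> * indicator D \<theta>)" by simp
  qed simp
  have odd_0: "integral\<^sup>L lborel odd_part = 0"
  proof (rule integral_odd_eq_0)
    fix t
    have "m - t \<in> D \<longleftrightarrow> m + t \<in> D" by (simp add: D_def dist_norm)
    then show "odd_part (m - t) = - odd_part (m + t)"
      using Q_even[of t] by (simp add: odd_part_def indicator_def)
  qed simp
  have w_int: "integrable lborel (\<lambda>\<theta>. indicator D \<theta> *\<^sub>R ((\<phi> \<theta> * W \<theta>) *\<^sub>R (\<theta> - m)))"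
    using moment_integrable by (rule integrable_mult_indicator[rotated]) simp
  have g_int: "integrable lborel (g k)"
    and g_val: "integral\<^sup>L lborel (g k) = s ^ (DIM('a) + k) * gaussian_moment TYPE('a) k \<kappa>" if "even k" for k
    unfolding g_def using scaled_gaussian_moment[OF scale(1) constants(1) that, of m] by auto
  have "(LINT \<theta>:D|lborel. (\<phi> \<theta> * W \<theta>) *\<^sub>R (\<theta> - m))
      = (LINT \<theta>|lborel. indicator D \<theta> *\<^sub>R ((\<phi> \<theta> * W \<theta>) *\<^sub>R (\<theta> - m)) - W m *\<^sub>R odd_part \<theta>)"
    unfolding set_lebesgue_integral_def using w_int odd_int odd_0 by simp
  also have "\<dots> = (LINT \<theta>|lborel. indicator D \<theta> *\<^sub>R (E \<theta> *\<^sub>R (\<theta> - m)))"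
    by (rule Bochner_Integration.integral_cong)
       (auto simp: E_def odd_part_def indicator_def scaleR_left_diff_distrib)
  also have "norm \<dots> \<le> (LINT \<theta>|lborel. p1 * K / s\<^sup>2 * g 4 \<theta> + L * g 2 \<theta>)"
  proof (rule Bochner_Integration.integral_norm_bound_integral)
    show "integrable lborel (\<lambda>\<theta>. p1 * K / s\<^sup>2 * g 4 \<theta> + L * g 2 \<theta>)"
      using g_int by auto
    have "integrable lborel (\<lambda>\<theta>. indicator D \<theta> *\<^sub>R ((\<phi> \<theta> * W \<theta>) *\<^sub>R (\<theta> - m)) - W m *\<^sub>R odd_part \<theta>)"
      using w_int odd_int by auto
    then show "integrable lborel (\<lambda>\<theta>. indicator D \<theta> *\<^sub>R (E \<theta> *\<^sub>R (\<theta> - m)))"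
      by (rule back_subst[where P = "integrable lborel"])
         (auto simp: fun_eq_iff E_def odd_part_def indicator_def scaleR_left_diff_distrib)
    fix \<theta>
    show "norm (indicator D \<theta> *\<^sub>R (E \<theta> *\<^sub>R (\<theta> - m))) \<le> p1 * K / s\<^sup>2 * g 4 \<theta> + L * g 2 \<theta>"
    proof (cases "\<theta> \<in> D")
      case True
      then have \<theta>: "\<theta> \<in> cball m \<delta>" by (simp add: D_def)
      then have "K * norm (\<theta> - m) \<le> \<kappa>"
        using constants mult_left_mono[of "norm (\<theta> - m)" \<delta> K]
        by (auto simp: dist_norm norm_minus_commute)
      then have "\<bar>E \<theta>\<bar> * norm (\<theta> - m)
          \<le> (p1 * K / s\<^sup>2 * norm (\<theta> - m) ^ 4 + L * (norm (\<theta> - m))\<^sup>2) * exp (- \<kappa> * (norm (\<theta> - m))\<^sup>2 / s\<^sup>2)"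
        unfolding E_def using \<theta>
        by (intro perturbed_gaussian_error scale(1) norm_ge_zero \<phi>_pos Q_lower \<phi>_near W_Lipschitz
            W_nonneg W_upper constants(6))
      also have "\<dots> = p1 * K / s\<^sup>2 * g 4 \<theta> + L * g 2 \<theta>"
        by (simp only: g_def algebra_simps)
      finally show ?thesis using True by simp
    next
      case False
      have "0 \<le> p1" using W_nonneg[of m] W_upper by linarith
      then show ?thesis using False constants by (simp add: g_def)
    qed
  qed
  also have "\<dots> = p1 * K / s\<^sup>2 * integral\<^sup>L lborel (g 4) + L * integral\<^sup>L lborel (g 2)"
    using g_int[of 4] g_int[of 2] by simp
  also have "\<dots> = s ^ (DIM('a) + 2) * (p1 * K * gaussian_moment TYPE('a) 4 \<kappa> + L * gaussian_moment TYPE('a) 2 \<kappa>)"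
  proof -
    have "s ^ (DIM('a) + 4) = s ^ (DIM('a) + 2) * s\<^sup>2"
      by (simp add: power_add eval_nat_numeral mult_ac)
    then show ?thesis using scale(1) by (simp add: g_val distrib_left)
  qed
  finally show ?thesis by (simp add: D_def)
qed

text \<open>
  Any power of \<open>s\<close> beats \<open>exp (- c / s\<^sup>2)\<close>; the one chosen here matches the contribution of the ball.
\<close>

lemma first_moment_far:
  "norm (LINT \<theta>:- cball m \<delta>|lborel. (\<phi> \<theta> * W \<theta>) *\<^sub>R (\<theta> - m))
    \<le> s ^ (DIM('a) + 2) * (A * fact (DIM('a) + 1) / c ^ (DIM('a) + 1))"
proof -
  have A: "0 \<le> A"
    by (rule order_trans[OF integral_nonneg_AE W_moment(2)]) (simp add: W_nonneg)
  have "norm (LINT \<theta>:- cball m \<delta>|lborel. (\<phi> \<theta> * W \<theta>) *\<^sub>R (\<theta> - m))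
      \<le> (LINT \<theta>|lborel. exp (- c / s\<^sup>2) * (W \<theta> * norm (\<theta> - m)))"
    unfolding set_lebesgue_integral_def
  proof (rule Bochner_Integration.integral_norm_bound_integral)
    show "integrable lborel (\<lambda>\<theta>. indicator (- cball m \<delta>) \<theta> *\<^sub>R ((\<phi> \<theta> * W \<theta>) *\<^sub>R (\<theta> - m)))"
      using moment_integrable by (rule integrable_mult_indicator[rotated]) simp
    show "integrable lborel (\<lambda>\<theta>. exp (- c / s\<^sup>2) * (W \<theta> * norm (\<theta> - m)))"
      using W_moment(1) by (rule integrable_mult_right)
    fix \<theta>
    have "\<phi> \<theta> * (W \<theta> * norm (\<theta> - m)) \<le> exp (- c / s\<^sup>2) * (W \<theta> * norm (\<theta> - m))" if "\<theta> \<notin> cball m \<delta>"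
      using \<phi>_far[OF that] W_nonneg[of \<theta>] by (cases "W \<theta> = 0") (auto intro!: mult_right_mono)
    then show "norm (indicator (- cball m \<delta>) \<theta> *\<^sub>R ((\<phi> \<theta> * W \<theta>) *\<^sub>R (\<theta> - m)))
        \<le> exp (- c / s\<^sup>2) * (W \<theta> * norm (\<theta> - m))"
      using W_nonneg[of \<theta>] \<phi>_nonneg[of \<theta>] by (auto simp: indicator_def abs_mult mult.assoc)
  qed
  also have "\<dots> = exp (- c / s\<^sup>2) * (LINT \<theta>|lborel. W \<theta> * norm (\<theta> - m))"
    using W_moment(1) by simp
  also have "\<dots> \<le> (fact (DIM('a) + 1) * s ^ (DIM('a) + 2) / c ^ (DIM('a) + 1)) * A"
  proof (rule mult_mono)
    define k where "k = DIM('a) + 1"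
    have "(c / s\<^sup>2) ^ k \<le> fact k * exp (c / s\<^sup>2)"
      using constants by (intro power_le_fact_mult_exp) simp
    then have "exp (- (c / s\<^sup>2)) * (c / s\<^sup>2) ^ k \<le> exp (- (c / s\<^sup>2)) * (fact k * exp (c / s\<^sup>2))"
      by (rule mult_left_mono) simp
    also have "\<dots> = fact k" by (simp add: exp_minus)
    finally have "exp (- (c / s\<^sup>2)) * (c / s\<^sup>2) ^ k \<le> fact k" .
    moreover have "0 < (c / s\<^sup>2) ^ k" using constants scale by simp
    ultimately have "exp (- (c / s\<^sup>2)) \<le> fact k / (c / s\<^sup>2) ^ k"
      by (simp only: pos_le_divide_eq)
    also have "\<dots> = fact k * s ^ (2 * k) / c ^ k"
      by (simp add: power_divide power_mult)
    also have "\<dots> \<le> fact k * s ^ (DIM('a) + 2) / c ^ k"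
    proof -
      have "s ^ (2 * k) \<le> s ^ (DIM('a) + 2)"
        using scale by (intro power_decreasing) (auto simp: k_def)
      then show ?thesis using constants by (intro divide_right_mono mult_left_mono) auto
    qed
    finally show "exp (- c / s\<^sup>2) \<le> fact (DIM('a) + 1) * s ^ (DIM('a) + 2) / c ^ (DIM('a) + 1)"
      by (simp add: k_def)
    show "0 \<le> fact (DIM('a) + 1) * s ^ (DIM('a) + 2) / c ^ (DIM('a) + 1)"
      using constants scale by simp
    show "0 \<le> (LINT \<theta>|lborel. W \<theta> * norm (\<theta> - m))"
      using W_nonneg by (intro integral_nonneg_AE) simp
  qed (rule W_moment)
  finally show ?thesis by (simp add: field_simps)
qed

lemma first_moment:
  "norm (LINT \<theta>|lborel. (\<phi> \<theta> * W \<theta>) *\<^sub>R (\<theta> - m))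
    \<le> s ^ (DIM('a) + 2) *
      (p1 * K * gaussian_moment TYPE('a) 4 \<kappa> + L * gaussian_moment TYPE('a) 2 \<kappa>
        + A * fact (DIM('a) + 1) / c ^ (DIM('a) + 1))"
proof -
  let ?v = "\<lambda>\<theta>. (\<phi> \<theta> * W \<theta>) *\<^sub>R (\<theta> - m)"
  have si: "set_integrable lborel B ?v" if "B \<in> sets borel" for B
    unfolding set_integrable_def
    using that moment_integrable by (intro integrable_mult_indicator) auto
  have "(LINT \<theta>|lborel. ?v \<theta>) = (LINT \<theta>:cball m \<delta> \<union> - cball m \<delta>|lborel. ?v \<theta>)"
    by (simp add: set_lebesgue_integral_def)
  also have "\<dots> = (LINT \<theta>:cball m \<delta>|lborel. ?v \<theta>) + (LINT \<theta>:- cball m \<delta>|lborel. ?v \<theta>)"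
    by (rule set_integral_Un) (auto intro: si)
  also have "norm \<dots> \<le> norm (LINT \<theta>:cball m \<delta>|lborel. ?v \<theta>) + norm (LINT \<theta>:- cball m \<delta>|lborel. ?v \<theta>)"
    by (rule norm_triangle_ineq)
  also note add_mono[OF first_moment_near first_moment_far]
  finally show ?thesis by (simp add: distrib_left)
qed

end

text \<open>
  The powers \<open>s ^ DIM('a)\<close> of numerator and denominator cancel.  The constant comes before \<open>m\<close>,
  \<open>s\<close>, \<open>Q\<close>, \<open>\<phi>\<close> and \<open>W\<close> in the quantification, as uniformity over samples requires.
\<close>

lemma first_moment_le_mass:
  assumes "0 < \<kappa>" "0 \<le> K" "0 < c" "0 < p0" "0 \<le> L" "0 \<le> p1" "0 \<le> A"
  shows "\<exists>C>0. \<forall>(m :: 'a::euclidean_space) s Q \<phi> W. peaked_weight \<kappa> \<Lambda> K \<delta> c p0 p1 L A m s Q \<phi> W \<longrightarrow>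
    norm (LINT \<theta>|lborel. (\<phi> \<theta> * W \<theta>) *\<^sub>R (\<theta> - m)) \<le> C * s\<^sup>2 * (LINT \<theta>|lborel. \<phi> \<theta> * W \<theta>)"
proof -
  define U where "U = p1 * K * gaussian_moment TYPE('a) 4 \<kappa> + L * gaussian_moment TYPE('a) 2 \<kappa>
        + A * fact (DIM('a) + 1) / c ^ (DIM('a) + 1)"
  define V where "V = p0 * exp (- (\<Lambda> + \<kappa>)) * unit_ball_vol DIM('a)"
  have U: "0 \<le> U" using assms gaussian_moment_nonneg[where 'a = 'a] by (simp add: U_def)
  have V: "0 < V" using assms by (simp add: V_def)
  \<comment> \<open>adding 1 keeps the constant positive when \<open>U = 0\<close>\<close>
  have "norm (LINT \<theta>|lborel. (\<phi> \<theta> * W \<theta>) *\<^sub>R (\<theta> - m)) \<le> (U + 1) / V * s\<^sup>2 * (LINT \<theta>|lborel. \<phi> \<theta> * W \<theta>)"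
    if "peaked_weight \<kappa> \<Lambda> K \<delta> c p0 p1 L A m s Q \<phi> W" for m :: 'a and s Q \<phi> W
  proof -
    interpret peaked_weight \<kappa> \<Lambda> K \<delta> c p0 p1 L A m s Q \<phi> W by (rule that)
    have "norm (LINT \<theta>|lborel. (\<phi> \<theta> * W \<theta>) *\<^sub>R (\<theta> - m)) \<le> s ^ (DIM('a) + 2) * U"
      using first_moment by (simp add: U_def)
    also have "\<dots> \<le> s ^ (DIM('a) + 2) * (U + 1)"
      using scale by (intro mult_left_mono) auto
    also have "\<dots> = (U + 1) / V * s\<^sup>2 * (V * s ^ DIM('a))"
      using V by (simp add: power_add power2_eq_square)
    also have "\<dots> \<le> (U + 1) / V * s\<^sup>2 * (LINT \<theta>|lborel. \<phi> \<theta> * W \<theta>)"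
      using mass_lower U V by (intro mult_left_mono) (auto simp: V_def mult.assoc)
    finally show ?thesis .
  qed
  then show ?thesis using U V by (intro exI[of _ "(U + 1) / V"]) auto
qed

section \<open>Regularity of the prior\<close>

text \<open>
  Halving the radius gives a compact ball, on which the prior and its gradient attain their bounds.
\<close>

lemma twice_cont_diff_bounds:
  assumes "0 < r" and pos: "\<And>\<theta>. \<theta> \<in> ball z r \<Longrightarrow> 0 < \<pi> \<theta>"
    and "twice_cont_diff_on (ball z r) \<pi>"
  obtains p0 p1 L where "0 < p0" "0 \<le> p1" "0 \<le> L"
    and "\<And>\<theta>. \<theta> \<in> cball z (r / 2) \<Longrightarrow> p0 \<le> \<pi> \<theta> \<and> \<pi> \<theta> \<le> p1"
    and "\<And>\<theta> \<tau>. \<theta> \<in> cball z (r / 2) \<Longrightarrow> \<tau> \<in> cball z (r / 2) \<Longrightarrow> \<bar>\<pi> \<theta> - \<pi> \<tau>\<bar> \<le> L * norm (\<theta> - \<tau>)"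
proof -
  let ?C = "cball z (r / 2)"
  obtain D D2 where D: "\<And>\<theta>. \<theta> \<in> ball z r \<Longrightarrow> (\<pi> has_derivative (\<lambda>v. D \<theta> \<bullet> v)) (at \<theta>)"
    and D2: "\<And>\<theta>. \<theta> \<in> ball z r \<Longrightarrow> (D has_derivative (\<lambda>v. D2 \<theta> *v v)) (at \<theta>)"
    using assms(3) unfolding twice_cont_diff_on_def by blast
  have sub: "?C \<subseteq> ball z r" using assms(1) by auto
  have cont: "continuous_on ?C \<pi>" "continuous_on ?C D"
    by (rule has_derivative_continuous_on[OF has_derivative_at_withinI[OF D[OF subsetD[OF sub]]]],
        assumption)
       (rule has_derivative_continuous_on[OF has_derivative_at_withinI[OF D2[OF subsetD[OF sub]]]])
  have C: "compact ?C" "?C \<noteq> {}" using assms(1) by auto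
  obtain x0 where x0: "x0 \<in> ?C" "\<And>\<theta>. \<theta> \<in> ?C \<Longrightarrow> \<pi> x0 \<le> \<pi> \<theta>"
    using continuous_attains_inf[OF C cont(1)] by blast
  obtain x1 where x1: "x1 \<in> ?C" "\<And>\<theta>. \<theta> \<in> ?C \<Longrightarrow> \<pi> \<theta> \<le> \<pi> x1"
    using continuous_attains_sup[OF C cont(1)] by blast
  have "continuous_on ?C (\<lambda>\<theta>. norm (D \<theta>))" using cont(2) by (intro continuous_intros)
  then obtain x2 where x2: "x2 \<in> ?C" "\<And>\<theta>. \<theta> \<in> ?C \<Longrightarrow> norm (D \<theta>) \<le> norm (D x2)"
    using continuous_attains_sup[OF C] by blast
  show thesis
  proof (rule that)
    show "0 < \<pi> x0" "0 \<le> \<pi> x1"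
      using pos[OF subsetD[OF sub x0(1)]] pos[OF subsetD[OF sub x1(1)]] by simp_all
    show "\<pi> x0 \<le> \<pi> \<theta> \<and> \<pi> \<theta> \<le> \<pi> x1" if "\<theta> \<in> ?C" for \<theta> using x0 x1 that by blast
    fix \<theta> \<tau> assume *: "\<theta> \<in> ?C" "\<tau> \<in> ?C"
    have "norm (\<pi> \<theta> - \<pi> \<tau>) \<le> norm (D x2) * norm (\<theta> - \<tau>)"
    proof (rule differentiable_bound[where S = ?C and f' = "\<lambda>\<theta> v. D \<theta> \<bullet> v"])
      fix \<theta> assume \<theta>: "\<theta> \<in> ?C"
      show "(\<pi> has_derivative (\<lambda>v. D \<theta> \<bullet> v)) (at \<theta> within ?C)"
        by (rule has_derivative_at_withinI[OF D[OF subsetD[OF sub \<theta>]]])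
      show "onorm (\<lambda>v. D \<theta> \<bullet> v) \<le> norm (D x2)"
      proof (rule onorm_le)
        fix v
        show "norm (D \<theta> \<bullet> v) \<le> norm (D x2) * norm v"
          using Cauchy_Schwarz_ineq2[of "D \<theta>" v] mult_right_mono[OF x2(2)[OF \<theta>], of "norm v"] by simp
      qed
    qed (use * in auto)
    then show "\<bar>\<pi> \<theta> - \<pi> \<tau>\<bar> \<le> norm (D x2) * norm (\<theta> - \<tau>)" by simp
  qed simp
qed

section \<open>Expansion and decay of the log-likelihood\<close>

lemma cubic_form_scaleR: "cubic_form S (c *\<^sub>R h) = c ^ 3 * cubic_form S h"
  by (simp add: cubic_form_def sum_distrib_left power3_eq_cube mult.assoc mult.left_commute)

text \<open>
  Let \<open>l\<close> be a log-likelihood ratio with respect to its maximum, so that \<open>l \<le> 0\<close>.  At a point \<open>u\<close>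
  with \<open>norm u = \<delta>\<close> the expansion turns \<open>l u \<le> 0\<close> into an upper bound for \<open>S u\<close>.  Since \<open>S\<close> is
  odd, the same bound at \<open>- u\<close> controls \<open>|S u|\<close>, and homogeneity carries it to all \<open>t\<close> as a
  multiple of \<open>norm t ^ 3\<close>, of the same kind as the remainder.
\<close>

lemma cubic_term_absorbed:
  fixes l q S :: "'a::real_normed_vector \<Rightarrow> real"
  assumes "0 < \<delta>" and "0 < n" and "0 \<le> M"
    and le0: "\<And>t. norm t \<le> \<delta> \<Longrightarrow> l t \<le> 0"
    and q: "\<And>t. q t \<le> \<Lambda> * (norm t)\<^sup>2"
    and S: "\<And>c t. S (c *\<^sub>R t) = c ^ 3 * S t"
    and expand: "\<And>t. norm t \<le> \<delta> \<Longrightarrow> \<bar>l t + n * q t - n * S t\<bar> \<le> n * M * norm t ^ 4"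
    and t: "norm t \<le> \<delta>"
  shows "\<bar>l t + n * q t\<bar> \<le> n * ((\<Lambda> / \<delta> + 2 * M * \<delta>) * norm t ^ 3)"
proof -
  have upper: "S u \<le> \<Lambda> * \<delta>\<^sup>2 + M * \<delta> ^ 4" if "norm u = \<delta>" for u
  proof -
    have "n * S u \<le> n * q u + n * M * \<delta> ^ 4"
      using le0[of u] expand[of u] that by (simp add: abs_le_iff)
    then have "n * S u \<le> n * (q u + M * \<delta> ^ 4)" by (simp add: algebra_simps)
    then have "S u \<le> q u + M * \<delta> ^ 4" using assms(2) by simp
    then show ?thesis using q[of u] that by simp
  qed
  have "\<bar>S t\<bar> \<le> (\<Lambda> / \<delta> + M * \<delta>) * norm t ^ 3"
  proof (cases "t = 0")
    case True
    then show ?thesis using S[of 0 0] by simp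
  next
    case False
    define \<rho> where "\<rho> = norm t / \<delta>"
    have \<rho>: "0 < \<rho>" using False assms(1) by (simp add: \<rho>_def)
    define u where "u = (1 / \<rho>) *\<^sub>R t"
    have u: "norm u = \<delta>" using False assms(1) by (simp add: u_def \<rho>_def)
    have "t = \<rho> *\<^sub>R u" using \<rho> by (simp add: u_def)
    then have St: "S t = \<rho> ^ 3 * S u" using S by simp
    have "\<bar>S u\<bar> \<le> \<Lambda> * \<delta>\<^sup>2 + M * \<delta> ^ 4"
      using upper[OF u] upper[of "- u"] S[of "-1" u] u by (simp add: abs_le_iff)
    then have "\<bar>S t\<bar> \<le> \<rho> ^ 3 * (\<Lambda> * \<delta>\<^sup>2 + M * \<delta> ^ 4)"
      using \<rho> by (simp add: St abs_mult)
    also have "\<dots> = (\<Lambda> / \<delta> + M * \<delta>) * norm t ^ 3"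
      using assms(1) by (simp add: \<rho>_def field_simps eval_nat_numeral)
    finally show ?thesis .
  qed
  moreover have "M * norm t ^ 4 \<le> M * \<delta> * norm t ^ 3"
    using mult_right_mono[OF t, of "M * norm t ^ 3"] assms(3)
    by (simp add: eval_nat_numeral mult_ac)
  ultimately have "\<bar>S t\<bar> + M * norm t ^ 4 \<le> (\<Lambda> / \<delta> + 2 * M * \<delta>) * norm t ^ 3"
    by (simp add: algebra_simps)
  then have "n * (\<bar>S t\<bar> + M * norm t ^ 4) \<le> n * ((\<Lambda> / \<delta> + 2 * M * \<delta>) * norm t ^ 3)"
    using assms(2) by simp
  moreover have "\<bar>l t + n * q t\<bar> \<le> n * \<bar>S t\<bar> + n * M * norm t ^ 4"
  proof -
    have "\<bar>l t + n * q t\<bar> \<le> \<bar>n * S t\<bar> + \<bar>l t + n * q t - n * S t\<bar>" by linarith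
    also have "\<bar>n * S t\<bar> = n * \<bar>S t\<bar>" using assms(2) by (simp add: abs_mult)
    finally show ?thesis using expand[OF t] by linarith
  qed
  ultimately show ?thesis by (simp add: distrib_left)
qed

text \<open>
  The bound on the extended-real remainder already forces the likelihood to be positive near the
  MLE.  In terms of \<open>t = h / sqrt (\<alpha> n * n)\<close> every term carries the factor \<open>\<alpha> n\<close>; after division
  by it the expansion is one of the plain log-likelihood and can be used with any exponent.
\<close>

lemma remainder_bound_real:
  assumes sup: "\<not> (SUP h\<in>{h. norm h / sqrt (\<alpha> n * real n) \<le> \<delta>}.
        \<bar>remainder \<Theta> f \<theta>h \<alpha> H S n x h\<bar> - ereal (M / (\<alpha> n * real n) * norm h ^ 4)) > 0"
    and pos: "0 < \<alpha> n" "0 < n" "0 < \<delta>" and t: "norm t \<le> \<delta>"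
  shows "\<theta>h n x \<in> \<Theta>" and "0 < f n (\<theta>h n x) x"
    and "\<theta>h n x + t \<in> \<Theta>" and "0 < f n (\<theta>h n x + t) x"
    and "\<bar>ln (f n (\<theta>h n x + t) x) - ln (f n (\<theta>h n x) x)
      + real n * (t \<bullet> (H *v t) / 2) - real n * (cubic_form S t / 6)\<bar> \<le> real n * M * norm t ^ 4"
proof -
  define N where "N = \<alpha> n * real n"
  have N: "0 < N" using pos by (simp add: N_def)
  let ?m = "\<theta>h n x"
  have le: "\<bar>remainder \<Theta> f \<theta>h \<alpha> H S n x h\<bar> \<le> ereal (M / N * norm h ^ 4)"
    if "norm h / sqrt N \<le> \<delta>" for h
  proof -
    have "\<bar>remainder \<Theta> f \<theta>h \<alpha> H S n x h\<bar> - ereal (M / N * norm h ^ 4) \<le> 0"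
      using sup that unfolding not_less N_def[symmetric] SUP_le_iff by blast
    then show ?thesis by (cases "\<bar>remainder \<Theta> f \<theta>h \<alpha> H S n x h\<bar>") auto
  qed
  have fin_m: "?m \<in> \<Theta> \<and> 0 < f n ?m x"
  proof (rule ccontr)
    assume "\<not> ?thesis"
    then have "loglik \<Theta> f n x ?m = - \<infinity>" by (auto simp: loglik_def)
    \<comment> \<open>the difference of the log-likelihoods at \<open>h = 0\<close> is \<open>- \<infinity> - (- \<infinity>)\<close>, which is \<open>\<infinity>\<close> by convention\<close>
    then have "\<bar>remainder \<Theta> f \<theta>h \<alpha> H S n x 0\<bar> = \<infinity>"
      using pos by (simp add: remainder_def)
    moreover have "\<bar>remainder \<Theta> f \<theta>h \<alpha> H S n x 0\<bar> \<le> ereal (M / N * norm (0 :: real ^ 'a) ^ 4)"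
      by (rule le) (use pos in simp)
    ultimately show False by simp
  qed
  then show "?m \<in> \<Theta>" "0 < f n ?m x" by auto
  define h where "h = sqrt N *\<^sub>R t"
  have h: "?m + h /\<^sub>R sqrt (\<alpha> n * real n) = ?m + t" using N by (simp add: h_def flip: N_def)
  have le_h: "\<bar>remainder \<Theta> f \<theta>h \<alpha> H S n x h\<bar> \<le> ereal (M / N * norm h ^ 4)"
    by (rule le) (use N t in \<open>simp add: h_def\<close>)
  have fin_t: "?m + t \<in> \<Theta> \<and> 0 < f n (?m + t) x"
  proof (rule ccontr)
    assume "\<not> ?thesis"
    then have "loglik \<Theta> f n x (?m + t) = - \<infinity>" by (auto simp: loglik_def)
    then have "\<bar>remainder \<Theta> f \<theta>h \<alpha> H S n x h\<bar> = \<infinity>"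
      using pos fin_m unfolding remainder_def h by (simp add: loglik_def)
    then show False using le_h by simp
  qed
  then show "?m + t \<in> \<Theta>" "0 < f n (?m + t) x" by auto
  define r where "r = sqrt N"
  have r: "0 < r" and N_r: "N = r * r" using N by (simp_all add: r_def)
  let ?l = "ln (f n (?m + t) x) - ln (f n ?m x)"
  have "\<bar>\<alpha> n * ?l + 1 / 2 * (h \<bullet> (H *v h)) - 1 / (6 * sqrt N) * cubic_form S h\<bar> \<le> M / N * norm h ^ 4"
    using le_h fin_m fin_t unfolding remainder_def h by (simp add: loglik_def flip: N_def)
  moreover have "h \<bullet> (H *v h) = N * (t \<bullet> (H *v t))"
    by (simp add: h_def matrix_vector_mult_scaleR N_r r_def[symmetric] mult.assoc)
  moreover have "1 / (6 * sqrt N) * cubic_form S h = N * (cubic_form S t / 6)"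
    unfolding h_def cubic_form_scaleR r_def[symmetric] N_r using r by (simp add: power3_eq_cube)
  moreover have "M / N * norm h ^ 4 = N * (M * norm t ^ 4)"
    unfolding h_def r_def[symmetric] N_r using r by (simp add: power_mult_distrib power4_eq_xxxx)
  ultimately have "\<bar>\<alpha> n * (?l + real n * (t \<bullet> (H *v t) / 2) - real n * (cubic_form S t / 6))\<bar>
      \<le> \<alpha> n * (real n * M * norm t ^ 4)"
    by (simp add: N_def algebra_simps)
  then show "\<bar>?l + real n * (t \<bullet> (H *v t) / 2) - real n * (cubic_form S t / 6)\<bar> \<le> real n * M * norm t ^ 4"
    using pos by (simp add: abs_mult)
qed

lemma likelihood_decay_real:
  assumes sup: "\<not> (SUP \<theta>\<in>- ball (\<theta>h n x) \<delta>.
        ereal (1 / real n) * loglik \<Theta> f n x \<theta> - ereal (1 / real n) * loglik \<Theta> f n x (\<theta>h n x)) > ereal (- c)"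
    and m: "\<theta>h n x \<in> \<Theta>" "0 < f n (\<theta>h n x) x"
    and "0 < n" and \<theta>: "\<theta> \<in> \<Theta>" "\<theta> \<notin> ball (\<theta>h n x) \<delta>" and "0 \<le> f n \<theta> x"
  shows "f n \<theta> x \<le> f n (\<theta>h n x) x * exp (- c * real n)"
proof (cases "f n \<theta> x = 0")
  case False
  then have pos: "0 < f n \<theta> x" using assms(7) by simp
  have "ereal (1 / real n) * loglik \<Theta> f n x \<theta> - ereal (1 / real n) * loglik \<Theta> f n x (\<theta>h n x) \<le> ereal (- c)"
    using sup \<theta>(2) unfolding not_less SUP_le_iff by blast
  then have "ln (f n \<theta> x) / real n - ln (f n (\<theta>h n x) x) / real n \<le> - c"
    using m \<theta>(1) pos by (simp add: loglik_def)
  then have "ln (f n \<theta> x) \<le> ln (f n (\<theta>h n x) x) + - c * real n"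
    using assms(4) by (simp add: field_simps)
  then have "exp (ln (f n \<theta> x)) \<le> exp (ln (f n (\<theta>h n x) x) + - c * real n)" by simp
  then show ?thesis using pos m(2) unfolding exp_add by simp
qed (use m in simp)

section \<open>Bias of the posterior mean on a regular sample\<close>

text \<open>
  The quotient does not change if the unnormalised posterior density is multiplied by a constant
  \<open>b\<close>; the case of interest is \<open>b = 1 / f n m x powr a\<close> with the MLE as \<open>m\<close>, which turns the
  likelihood into a likelihood ratio.
\<close>

lemma posterior_mean_minus_eq:
  fixes f :: "nat \<Rightarrow> real ^ 'p \<Rightarrow> 'x \<Rightarrow> real"
  assumes Z: "set_integrable lborel \<Theta> (\<lambda>\<theta>. f n \<theta> x powr a * \<pi> \<theta>)"
      "0 < (LINT \<theta>:\<Theta>|lborel. f n \<theta> x powr a * \<pi> \<theta>)"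
    and mom: "integrable lborel (\<lambda>\<theta>. w \<theta> *\<^sub>R (\<theta> - m))"
    and w: "\<And>\<theta>. w \<theta> = b * (indicator \<Theta> \<theta> * (f n \<theta> x powr a * \<pi> \<theta>))" and b: "0 < b"
  shows "0 < integral\<^sup>L lborel w"
    and "posterior_mean \<Theta> f \<pi> n a x - m = (1 / integral\<^sup>L lborel w) *\<^sub>R (LINT \<theta>|lborel. w \<theta> *\<^sub>R (\<theta> - m))"
proof -
  define v where "v \<theta> = indicator \<Theta> \<theta> * (f n \<theta> x powr a * \<pi> \<theta>)" for \<theta>
  define Z where "Z = integral\<^sup>L lborel v"
  have v_int: "integrable lborel v" and Z_pos: "0 < Z"
    and Z_eq: "(LINT \<theta>:\<Theta>|lborel. f n \<theta> x powr a * \<pi> \<theta>) = Z"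
    using Z by (simp_all add: set_integrable_def set_lebesgue_integral_def v_def[abs_def] Z_def)
  have w_eq: "w = (\<lambda>\<theta>. b * v \<theta>)" by (simp add: fun_eq_iff w v_def)
  have int_w: "integral\<^sup>L lborel w = b * Z" by (simp add: w_eq Z_def)
  then show "0 < integral\<^sup>L lborel w" using b Z_pos by simp
  have "integrable lborel (\<lambda>\<theta>. (1 / b) *\<^sub>R (w \<theta> *\<^sub>R (\<theta> - m)))"
    using mom by (intro integrable_scaleR_right)
  then have vm: "integrable lborel (\<lambda>\<theta>. v \<theta> *\<^sub>R (\<theta> - m))" using b by (simp add: w_eq)
  have "integrable lborel (\<lambda>\<theta>. v \<theta> *\<^sub>R (\<theta> - m) + v \<theta> *\<^sub>R m)"
    using vm v_int by (intro Bochner_Integration.integrable_add) auto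
  then have v\<theta>: "integrable lborel (\<lambda>\<theta>. v \<theta> *\<^sub>R \<theta>)" by (simp add: scaleR_diff_right)
  have comp: "posterior_mean \<Theta> f \<pi> n a x $ j = ((1 / Z) *\<^sub>R (LINT \<theta>|lborel. v \<theta> *\<^sub>R \<theta>)) $ j" for j
  proof -
    have "posterior_mean \<Theta> f \<pi> n a x $ j = (LINT \<theta>|lborel. (1 / Z) * (v \<theta> *\<^sub>R \<theta>) $ j)"
      unfolding posterior_mean_def posterior_density_def Z_eq
      by (simp add: set_lebesgue_integral_def v_def mult_ac)
    also have "\<dots> = (1 / Z) * (LINT \<theta>|lborel. (v \<theta> *\<^sub>R \<theta>) $ j)" by (rule integral_mult_right_zero)
    also have "(LINT \<theta>|lborel. (v \<theta> *\<^sub>R \<theta>) $ j) = (LINT \<theta>|lborel. v \<theta> *\<^sub>R \<theta>) $ j"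
      by (rule integral_bounded_linear[OF bounded_linear_vec_nth v\<theta>])
    finally show ?thesis by simp
  qed
  have "(LINT \<theta>|lborel. w \<theta> *\<^sub>R (\<theta> - m)) = b *\<^sub>R ((LINT \<theta>|lborel. v \<theta> *\<^sub>R \<theta>) - Z *\<^sub>R m)"
    using v\<theta> v_int by (simp add: w_eq scaleR_diff_right Z_def flip: scaleR_scaleR)
  moreover have "posterior_mean \<Theta> f \<pi> n a x = (1 / Z) *\<^sub>R (LINT \<theta>|lborel. v \<theta> *\<^sub>R \<theta>)"
    unfolding vec_eq_iff using comp by blast
  ultimately show "posterior_mean \<Theta> f \<pi> n a x - m
      = (1 / integral\<^sup>L lborel w) *\<^sub>R (LINT \<theta>|lborel. w \<theta> *\<^sub>R (\<theta> - m))"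
    using b Z_pos by (simp only: int_w) (simp add: scaleR_diff_right)
qed

text \<open>
  The conjunction of all requirements on a single sample, with likelihood function \<open>g\<close>, MLE \<open>m\<close> and
  sample size \<open>n\<close>.  The exponent of the posterior does not occur, so one regular sample serves all
  exponents.  The point \<open>z\<close> is the limit of the MLE and \<open>r\<close> a radius on which the prior is regular.
\<close>

definition regular_sample ::
    "(real ^ 'p) set \<Rightarrow> real ^ 'p \<Rightarrow> real \<Rightarrow> real \<Rightarrow> real \<Rightarrow> real \<Rightarrow> real \<Rightarrow> real \<Rightarrow>
     (real ^ 'p \<Rightarrow> real) \<Rightarrow> real ^ 'p \<Rightarrow> real ^ 'p ^ 'p \<Rightarrow> real \<Rightarrow> bool" where
  "regular_sample \<Theta> z r \<eta> \<Lambda> K \<delta> c g m H n \<longleftrightarrow>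
     m \<in> \<Theta> \<and> 0 < g m \<and> (\<forall>\<theta>\<in>\<Theta>. 0 \<le> g \<theta> \<and> g \<theta> \<le> g m) \<and> dist m z \<le> r / 4 \<and>
     (\<forall>v. \<eta> * (norm v)\<^sup>2 \<le> v \<bullet> (H *v v) \<and> v \<bullet> (H *v v) \<le> \<Lambda> * (norm v)\<^sup>2) \<and>
     (\<forall>t. norm t \<le> \<delta> \<longrightarrow> m + t \<in> \<Theta> \<and> 0 < g (m + t) \<and>
       \<bar>ln (g (m + t)) - ln (g m) + n * (t \<bullet> (H *v t) / 2)\<bar> \<le> n * (K * norm t ^ 3)) \<and>
     (\<forall>\<theta>\<in>\<Theta>. \<theta> \<notin> ball m \<delta> \<longrightarrow> g \<theta> \<le> g m * exp (- c * n))"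

text \<open>
  The Laplace estimate applies with \<open>\<phi> \<theta> = (g \<theta> / g m) powr a\<close>, with the prior as \<open>W\<close> and with
  scale \<open>s = 1 / sqrt (a n)\<close>.  The two lower bounds on \<open>a n\<close> say that \<open>s\<close> is at most 1 and at most \<open>\<delta>\<close>.
\<close>

lemma regular_sample_bias:
  fixes \<pi> :: "real ^ 'p \<Rightarrow> real"
  assumes \<Theta>: "open \<Theta>" and "0 < r"
    and prior: "\<And>\<theta>. \<theta> \<in> \<Theta> \<Longrightarrow> 0 \<le> \<pi> \<theta>" "set_integrable lborel \<Theta> \<pi>" "(LINT \<theta>:\<Theta>|lborel. \<pi> \<theta>) = 1"
      "set_integrable lborel \<Theta> (\<lambda>\<theta>. \<pi> \<theta> *\<^sub>R \<theta>)"
    and p: "0 < p0" "0 \<le> p1" "0 \<le> L"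
      "\<And>\<theta>. \<theta> \<in> cball z (r / 2) \<Longrightarrow> p0 \<le> \<pi> \<theta> \<and> \<pi> \<theta> \<le> p1"
      "\<And>\<theta> \<tau>. \<theta> \<in> cball z (r / 2) \<Longrightarrow> \<tau> \<in> cball z (r / 2) \<Longrightarrow> \<bar>\<pi> \<theta> - \<pi> \<tau>\<bar> \<le> L * norm (\<theta> - \<tau>)"
    and const: "0 < \<eta>" "0 \<le> K" "0 < \<delta>" "\<delta> \<le> r / 4" "K * \<delta> \<le> \<eta> / 4" "0 < c"
  shows "\<exists>C>0. \<forall>(f :: nat \<Rightarrow> real ^ 'p \<Rightarrow> 'x \<Rightarrow> real) n x m H a.
     regular_sample \<Theta> z r \<eta> \<Lambda> K \<delta> c (\<lambda>\<theta>. f n \<theta> x) m H (real n) \<longrightarrow> 0 < n \<longrightarrow> 0 < a \<longrightarrow>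
     1 \<le> a * real n \<longrightarrow> 1 \<le> \<delta>\<^sup>2 * (a * real n) \<longrightarrow>
     set_integrable lborel \<Theta> (\<lambda>\<theta>. f n \<theta> x powr a * \<pi> \<theta>) \<longrightarrow>
     0 < (LINT \<theta>:\<Theta>|lborel. f n \<theta> x powr a * \<pi> \<theta>) \<longrightarrow>
     norm (posterior_mean \<Theta> f \<pi> n a x - m) \<le> C / (a * real n)"
proof -
  define W where "W \<theta> = indicator \<Theta> \<theta> * \<pi> \<theta>" for \<theta>
  have [measurable]: "\<Theta> \<in> sets borel" using \<Theta> by simp
  have W_int: "integrable lborel W" "integral\<^sup>L lborel W = 1"
    using prior(2,3) by (simp_all add: set_integrable_def set_lebesgue_integral_def W_def[abs_def])
  have [measurable]: "W \<in> borel_measurable borel" using W_int(1) by (simp add: integrable_iff_bounded)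
  have W_nonneg: "0 \<le> W \<theta>" for \<theta> using prior(1) by (simp add: W_def indicator_def)
  have "integrable lborel (\<lambda>\<theta>. norm (W \<theta> *\<^sub>R \<theta>))"
    using prior(4) by (intro integrable_norm) (simp add: set_integrable_def W_def)
  then have W_norm_int: "integrable lborel (\<lambda>\<theta>. W \<theta> * norm \<theta>)"
    using W_nonneg by simp
  \<comment> \<open>a bound for the first absolute moment of the prior about any \<open>m\<close> near \<open>z\<close>\<close>
  define A where "A = (LINT \<theta>|lborel. W \<theta> * norm \<theta>) + (norm z + r)"
  have A: "0 \<le> A"
    unfolding A_def using W_nonneg \<open>0 < r\<close> by (intro add_nonneg_nonneg integral_nonneg_AE) auto
  obtain C where "0 < C" and C: "\<And>(m :: real ^ 'p) s Q \<phi> W.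
      peaked_weight (\<eta> / 4) (\<Lambda> / 2) K \<delta> c p0 p1 L A m s Q \<phi> W \<Longrightarrow>
      norm (LINT \<theta>|lborel. (\<phi> \<theta> * W \<theta>) *\<^sub>R (\<theta> - m)) \<le> C * s\<^sup>2 * (LINT \<theta>|lborel. \<phi> \<theta> * W \<theta>)"
    using first_moment_le_mass[where 'a = "real ^ 'p", of "\<eta> / 4" K c p0 L p1 A "\<Lambda> / 2" \<delta>] const p A
    by auto
  have "norm (posterior_mean \<Theta> f \<pi> n a x - m) \<le> C / (a * real n)"
    if reg: "regular_sample \<Theta> z r \<eta> \<Lambda> K \<delta> c (\<lambda>\<theta>. f n \<theta> x) m H (real n)"
      and "0 < n" "0 < a" and N: "1 \<le> a * real n" "1 \<le> \<delta>\<^sup>2 * (a * real n)"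
      and proper: "set_integrable lborel \<Theta> (\<lambda>\<theta>. f n \<theta> x powr a * \<pi> \<theta>)"
        "0 < (LINT \<theta>:\<Theta>|lborel. f n \<theta> x powr a * \<pi> \<theta>)"
    for f :: "nat \<Rightarrow> real ^ 'p \<Rightarrow> 'x \<Rightarrow> real" and n x m H a
  proof -
    define g where "g \<theta> = f n \<theta> x" for \<theta>
    have m: "m \<in> \<Theta>" "0 < g m" "dist m z \<le> r / 4"
      and g: "\<And>\<theta>. \<theta> \<in> \<Theta> \<Longrightarrow> 0 \<le> g \<theta>" "\<And>\<theta>. \<theta> \<in> \<Theta> \<Longrightarrow> g \<theta> \<le> g m"
      and H: "\<And>v. \<eta> * (norm v)\<^sup>2 \<le> v \<bullet> (H *v v)" "\<And>v. v \<bullet> (H *v v) \<le> \<Lambda> * (norm v)\<^sup>2"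
      and near: "\<And>t. norm t \<le> \<delta> \<Longrightarrow> m + t \<in> \<Theta>" "\<And>t. norm t \<le> \<delta> \<Longrightarrow> 0 < g (m + t)"
        "\<And>t. norm t \<le> \<delta> \<Longrightarrow>
          \<bar>ln (g (m + t)) - ln (g m) + real n * (t \<bullet> (H *v t) / 2)\<bar> \<le> real n * (K * norm t ^ 3)"
      and far: "\<And>\<theta>. \<theta> \<in> \<Theta> \<Longrightarrow> \<theta> \<notin> ball m \<delta> \<Longrightarrow> g \<theta> \<le> g m * exp (- c * real n)"
      using reg unfolding regular_sample_def g_def by blast+
    define s where "s = 1 / sqrt (a * real n)"
    have aN: "0 < a * real n" using N by simp
    have s: "0 < s" using aN by (simp add: s_def)
    have s2: "s\<^sup>2 = 1 / (a * real n)" using aN by (simp add: s_def power_divide)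
    define \<phi> where "\<phi> \<theta> = (g \<theta> / g m) powr a" for \<theta>
    define b where "b = 1 / g m powr a"
    have b: "0 < b" using m by (simp add: b_def)
    have w: "\<phi> \<theta> * W \<theta> = b * (indicator \<Theta> \<theta> * (f n \<theta> x powr a * \<pi> \<theta>))" for \<theta>
      using g(1)[of \<theta>] m by (auto simp: \<phi>_def W_def b_def indicator_def powr_divide g_def)
    have w_int: "integrable lborel (\<lambda>\<theta>. \<phi> \<theta> * W \<theta>)"
      unfolding w using proper(1) by (intro integrable_mult_right) (simp add: set_integrable_def)
    then have [measurable]: "(\<lambda>\<theta>. \<phi> \<theta> * W \<theta>) \<in> borel_measurable borel"
      by (simp add: integrable_iff_bounded)
    have Wm_int: "integrable lborel (\<lambda>\<theta>. W \<theta> * norm (\<theta> - m))"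
    proof (rule Bochner_Integration.integrable_bound)
      show "integrable lborel (\<lambda>\<theta>. W \<theta> * norm \<theta> + W \<theta> * norm m)"
        using W_norm_int W_int(1) by (intro Bochner_Integration.integrable_add) auto
      have "W \<theta> * norm (\<theta> - m) \<le> W \<theta> * norm \<theta> + W \<theta> * norm m" for \<theta>
        using mult_left_mono[OF norm_triangle_ineq4[of \<theta> m] W_nonneg[of \<theta>]] by (simp add: distrib_left)
      then show "AE \<theta> in lborel. norm (W \<theta> * norm (\<theta> - m)) \<le> norm (W \<theta> * norm \<theta> + W \<theta> * norm m)"
        using W_nonneg by (intro AE_I2) (simp add: abs_mult)
    qed measurable
    have mom_int: "integrable lborel (\<lambda>\<theta>. (\<phi> \<theta> * W \<theta>) *\<^sub>R (\<theta> - m))"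
    proof (rule Bochner_Integration.integrable_bound[OF Wm_int])
      \<comment> \<open>maximality of \<open>g m\<close> makes the moments of the prior dominate those of the posterior\<close>
      have "\<phi> \<theta> * W \<theta> \<le> W \<theta>" for \<theta>
      proof (cases "\<theta> \<in> \<Theta>")
        case True
        have "\<phi> \<theta> \<le> 1 powr a"
          unfolding \<phi>_def using g[OF True] m(2) \<open>0 < a\<close> by (intro powr_mono2) auto
        then show ?thesis using W_nonneg[of \<theta>] by (simp add: mult_left_le_one_le \<phi>_def)
      qed (simp add: W_def)
      then show "AE \<theta> in lborel. norm ((\<phi> \<theta> * W \<theta>) *\<^sub>R (\<theta> - m)) \<le> norm (W \<theta> * norm (\<theta> - m))"
        using W_nonneg by (intro AE_I2) (auto simp: abs_mult \<phi>_def intro!: mult_right_mono)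
    qed measurable
    have in_cball: "\<theta> \<in> cball z (r / 2)" "\<theta> \<in> \<Theta>" "norm (\<theta> - m) \<le> \<delta>" if "\<theta> \<in> cball m \<delta>" for \<theta>
    proof -
      show 1: "norm (\<theta> - m) \<le> \<delta>" using that by (simp add: dist_norm norm_minus_commute)
      show "\<theta> \<in> \<Theta>" using near(1)[OF 1] by simp
      show "\<theta> \<in> cball z (r / 2)"
        using that m(3) const(4) dist_triangle[of z \<theta> m] by (simp add: dist_commute)
    qed
    have m_cball: "m \<in> cball m \<delta>" using const(3) by simp
    have "peaked_weight (\<eta> / 4) (\<Lambda> / 2) K \<delta> c p0 p1 L A m s (\<lambda>t. t \<bullet> (H *v t) / 2) \<phi> W"
    proof
      show "s \<le> 1" using N aN by (simp add: s_def)
      have "s\<^sup>2 \<le> \<delta>\<^sup>2" using N aN by (simp add: s2 pos_divide_le_eq)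
      then show "s \<le> \<delta>" by (rule power2_le_imp_le) (use const(3) in simp)
      show "(\<lambda>t. t \<bullet> (H *v t) / 2) \<in> borel_measurable borel"
        using borel_measurable_quadratic_form[of H] by simp
      show "0 < \<eta> / 4" "K * \<delta> \<le> \<eta> / 4" "0 < p0" "0 < c" "0 \<le> K" "0 \<le> L" "0 < s"
        using const p s by simp_all
      show "(- t) \<bullet> (H *v (- t)) / 2 = t \<bullet> (H *v t) / 2" for t
        using matrix_vector_mult_scaleR[of H "-1" t] by simp
      show "2 * (\<eta> / 4) * (norm t)\<^sup>2 \<le> t \<bullet> (H *v t) / 2" for t using H(1)[of t] by simp
      show "t \<bullet> (H *v t) / 2 \<le> \<Lambda> / 2 * (norm t)\<^sup>2" for t using H(2)[of t] by simp
      show "0 \<le> \<phi> \<theta>" for \<theta> by (simp add: \<phi>_def)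
      show "W m \<le> p1" using p(2) p(4)[OF in_cball(1)[OF m_cball]] by (simp add: W_def indicator_def)
      show "(LINT \<theta>|lborel. W \<theta> * norm (\<theta> - m)) \<le> A"
      proof -
        have "(LINT \<theta>|lborel. W \<theta> * norm (\<theta> - m)) \<le> (LINT \<theta>|lborel. W \<theta> * norm \<theta> + W \<theta> * norm m)"
        proof (rule integral_mono)
          show "W \<theta> * norm (\<theta> - m) \<le> W \<theta> * norm \<theta> + W \<theta> * norm m" for \<theta>
            using mult_left_mono[OF norm_triangle_ineq4[of \<theta> m] W_nonneg[of \<theta>]] by (simp add: distrib_left)
        qed (use W_norm_int W_int Wm_int in auto)
        also have "\<dots> = (LINT \<theta>|lborel. W \<theta> * norm \<theta>) + norm m"
          using W_norm_int W_int by simp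
        also have "norm m \<le> norm z + r"
          using m(3) norm_triangle_ineq2[of m z] \<open>0 < r\<close> by (simp add: dist_norm)
        finally show ?thesis by (simp add: A_def)
      qed
      show "\<phi> \<theta> \<le> exp (- c / s\<^sup>2)" if "\<theta> \<notin> cball m \<delta>" "W \<theta> \<noteq> 0" for \<theta>
      proof -
        have \<theta>: "\<theta> \<in> \<Theta>" using that(2) by (auto simp: W_def indicator_def split: if_splits)
        have "g \<theta> / g m \<le> exp (- c * real n)"
          using far[OF \<theta>] that(1) m(2) by (simp add: pos_divide_le_eq mult.commute)
        then have "\<phi> \<theta> \<le> exp (- c * real n) powr a"
          unfolding \<phi>_def using g(1)[OF \<theta>] m(2) \<open>0 < a\<close> by (intro powr_mono2) auto
        also have "\<dots> = exp (- c / s\<^sup>2)" by (simp add: powr_def s2 mult_ac)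
        finally show ?thesis .
      qed
      fix \<theta> assume "\<theta> \<in> cball m \<delta>"
      note \<theta> = in_cball[OF this]
      have W_eq: "W \<theta> = \<pi> \<theta>" "W m = \<pi> m" using \<theta> m by (simp_all add: W_def)
      have g_pos: "0 < g \<theta>" using near(2)[OF \<theta>(3)] by simp
      then show "0 < \<phi> \<theta>" using m by (simp add: \<phi>_def)
      show "p0 \<le> W \<theta>" using p(4)[OF \<theta>(1)] W_eq by simp
      show "\<bar>W \<theta> - W m\<bar> \<le> L * norm (\<theta> - m)"
        using p(5)[OF \<theta>(1) in_cball(1)[OF m_cball]] W_eq by simp
      have "ln (\<phi> \<theta>) + (\<theta> - m) \<bullet> (H *v (\<theta> - m)) / 2 / s\<^sup>2
          = a * (ln (g \<theta>) - ln (g m) + real n * ((\<theta> - m) \<bullet> (H *v (\<theta> - m)) / 2))"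
        using g_pos m(2) by (simp add: \<phi>_def ln_powr ln_div s2 algebra_simps)
      moreover have "\<bar>ln (g \<theta>) - ln (g m) + real n * ((\<theta> - m) \<bullet> (H *v (\<theta> - m)) / 2)\<bar>
          \<le> real n * (K * norm (\<theta> - m) ^ 3)"
        using near(3)[OF \<theta>(3)] by simp
      ultimately have "\<bar>ln (\<phi> \<theta>) + (\<theta> - m) \<bullet> (H *v (\<theta> - m)) / 2 / s\<^sup>2\<bar> \<le> a * (real n * (K * norm (\<theta> - m) ^ 3))"
        using \<open>0 < a\<close> by (simp add: abs_mult)
      then show "\<bar>ln (\<phi> \<theta>) + (\<theta> - m) \<bullet> (H *v (\<theta> - m)) / 2 / s\<^sup>2\<bar> \<le> K * norm (\<theta> - m) ^ 3 / s\<^sup>2"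
        by (simp add: s2 mult_ac)
    qed (fact W_nonneg Wm_int w_int mom_int)+
    note bound = C[OF this]
    let ?I = "LINT \<theta>|lborel. \<phi> \<theta> * W \<theta>"
    have I: "0 < ?I" and mean: "posterior_mean \<Theta> f \<pi> n a x - m
        = (1 / ?I) *\<^sub>R (LINT \<theta>|lborel. (\<phi> \<theta> * W \<theta>) *\<^sub>R (\<theta> - m))"
      using posterior_mean_minus_eq[where f = f and n = n and x = x and m = m and b = b and w = "\<lambda>\<theta>. \<phi> \<theta> * W \<theta>", OF proper mom_int w b] by simp_all
    have "norm (posterior_mean \<Theta> f \<pi> n a x - m) = norm (LINT \<theta>|lborel. (\<phi> \<theta> * W \<theta>) *\<^sub>R (\<theta> - m)) / ?I"
      using I by (simp add: mean)
    also have "\<dots> \<le> C * s\<^sup>2" using bound I by (simp add: pos_divide_le_eq)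
    also have "\<dots> = C / (a * real n)" by (simp add: s2)
    finally show ?thesis .
  qed
  then show ?thesis using \<open>0 < C\<close> by blast
qed

section \<open>The posterior mean and the MLE\<close>

text \<open>
  The constants are chosen in the order in which they depend on each other: the bounds on \<open>H\<close> and its
  inverse and the radius \<open>\<delta>0\<close> of the expansion from \<open>\<epsilon>\<close>, then the cubic constant \<open>K\<close>, then the
  smaller radius \<open>\<delta>\<close>, on which the cubic term is dominated by the quadratic one, then the decay rate
  \<open>c\<close> outside this smaller ball, and last the constant \<open>C\<close> of the deterministic bound.
\<close>

theorem theorem2:
  fixes X :: "(real ^ 'd) set"
    and \<nu> :: "(real ^ 'd) measure"
    and f0 :: "nat \<Rightarrow> 'd sample \<Rightarrow> real"
    and \<Theta> :: "(real ^ 'p) set"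
    and f :: "nat \<Rightarrow> real ^ 'p \<Rightarrow> 'd sample \<Rightarrow> real"
    and \<pi> :: "real ^ 'p \<Rightarrow> real"
    and \<theta>h :: "nat \<Rightarrow> 'd sample \<Rightarrow> real ^ 'p"
    and \<theta>s :: "real ^ 'p"
    and \<alpha> :: "nat \<Rightarrow> real"
  assumes "statistical_model X \<nu> f0 \<Theta> f \<pi>"
    and "tempering_rate \<alpha>"
    and "A0 (sample_law \<nu> f0) \<Theta> f \<theta>h \<theta>s"
    and "A1' \<Theta> \<pi> \<theta>s"
    and "A2' (sample_law \<nu> f0) \<Theta> f \<theta>h \<alpha>"
    and "A3' (sample_law \<nu> f0) \<Theta> f \<theta>h"
    and "proper_posteriors (sample_law \<nu> f0) \<Theta> f \<pi> (\<lambda>n x. \<alpha> n)"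
  shows "O_prob (sample_law \<nu> f0)
           (\<lambda>n x. posterior_mean \<Theta> f \<pi> n (\<alpha> n) x - \<theta>h n x) (\<lambda>n. 1 / (\<alpha> n * real n))
       \<and> (\<forall>\<alpha>h :: nat \<Rightarrow> 'd sample \<Rightarrow> real.
            (\<forall>n\<ge>1. \<forall>x\<in>space (sample_law \<nu> f0 n). 0 < \<alpha>h n x)
            \<longrightarrow> conv_in_prob (sample_law \<nu> f0) (\<lambda>n x. \<alpha>h n x / \<alpha> n) 1
            \<longrightarrow> proper_posteriors (sample_law \<nu> f0) \<Theta> f \<pi> \<alpha>h
            \<longrightarrow> O_prob (sample_law \<nu> f0)
                  (\<lambda>n x. posterior_mean \<Theta> f \<pi> n (\<alpha>h n x) x - \<theta>h n x) (\<lambda>n. 1 / (\<alpha> n * real n)))"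
proof -
  let ?P = "sample_law \<nu> f0"
  note model = assms(1) and rate = assms(2) and a0 = assms(3) and a1 = assms(4)
    and a2 = assms(5) and a3 = assms(6)
  \<comment> \<open>the data-dependent exponent covers both claims\<close>
  have bias: "O_prob ?P (\<lambda>n x. posterior_mean \<Theta> f \<pi> n (\<alpha>h n x) x - \<theta>h n x) (\<lambda>n. 1 / (\<alpha> n * real n))"
    if \<alpha>h_pos: "\<forall>n\<ge>1. \<forall>x\<in>space (?P n). 0 < \<alpha>h n x"
      and ratio: "conv_in_prob ?P (\<lambda>n x. \<alpha>h n x / \<alpha> n) 1"
      and proper: "proper_posteriors ?P \<Theta> f \<pi> \<alpha>h" for \<alpha>h :: "nat \<Rightarrow> 'd sample \<Rightarrow> real"
    unfolding O_prob_def
  proof (intro allI impI)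
    fix \<epsilon> :: real assume "0 < \<epsilon>"
    \<comment> \<open>there are eight exceptional events\<close>
    define e where "e = \<epsilon> / 8"
    have e: "0 < e" using \<open>0 < \<epsilon>\<close> by (simp add: e_def)
    obtain H S M where H_pd: "(\<lambda>n. pr (?P n) (\<lambda>x. \<not> sym_pos_def (H n x))) \<longlonglongrightarrow> 0"
      and H_bdd: "O_prob ?P H (\<lambda>_. 1)" and Hinv_bdd: "O_prob ?P (\<lambda>n x. matrix_inv (H n x)) (\<lambda>_. 1)"
      and expansion: "\<And>\<epsilon>. \<epsilon> > 0 \<Longrightarrow> \<exists>\<delta>>0. \<forall>\<^sub>F n in sequentially.
           pr (?P n) (\<lambda>x. (SUP h\<in>{h. norm h / sqrt (\<alpha> n * real n) \<le> \<delta>}.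
                \<bar>remainder \<Theta> f \<theta>h \<alpha> (H n x) (S n x) n x h\<bar>
                - ereal (M / (\<alpha> n * real n) * norm h ^ 4)) > 0) < ennreal \<epsilon>"
      using a2 unfolding A2'_def by blast
    obtain B1 where B1: "0 < B1" "\<forall>\<^sub>F n in sequentially. pr (?P n) (\<lambda>x. norm (H n x /\<^sub>R 1) > B1) < ennreal e"
      using H_bdd e unfolding O_prob_def by blast
    obtain B2 where B2: "0 < B2"
      "\<forall>\<^sub>F n in sequentially. pr (?P n) (\<lambda>x. norm (matrix_inv (H n x) /\<^sub>R 1) > B2) < ennreal e"
      using Hinv_bdd e unfolding O_prob_def by blast
    obtain \<delta>0 where \<delta>0: "0 < \<delta>0" "\<forall>\<^sub>F n in sequentially.
           pr (?P n) (\<lambda>x. (SUP h\<in>{h. norm h / sqrt (\<alpha> n * real n) \<le> \<delta>0}.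
                \<bar>remainder \<Theta> f \<theta>h \<alpha> (H n x) (S n x) n x h\<bar>
                - ereal (M / (\<alpha> n * real n) * norm h ^ 4)) > 0) < ennreal e"
      using expansion[OF e] by blast
    obtain r where r: "0 < r" "ball \<theta>s r \<subseteq> \<Theta>" "\<And>\<theta>. \<theta> \<in> ball \<theta>s r \<Longrightarrow> 0 < \<pi> \<theta>"
      "twice_cont_diff_on (ball \<theta>s r) \<pi>"
      using a1 unfolding A1'_def by blast
    obtain p0 p1 L where p: "0 < p0" "0 \<le> p1" "0 \<le> L"
      "\<And>\<theta>. \<theta> \<in> cball \<theta>s (r / 2) \<Longrightarrow> p0 \<le> \<pi> \<theta> \<and> \<pi> \<theta> \<le> p1"
      "\<And>\<theta> \<tau>. \<theta> \<in> cball \<theta>s (r / 2) \<Longrightarrow> \<tau> \<in> cball \<theta>s (r / 2) \<Longrightarrow> \<bar>\<pi> \<theta> - \<pi> \<tau>\<bar> \<le> L * norm (\<theta> - \<tau>)"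
      using twice_cont_diff_bounds[OF r(1,3,4)] by blast
    \<comment> \<open>the constant of \<open>cubic_term_absorbed\<close>, with \<open>|M|\<close> in case \<open>M\<close> is negative\<close>
    define K where "K = (B1 / 2) / \<delta>0 + 2 * \<bar>M\<bar> * \<delta>0"
    have K: "0 < K" using B1 \<delta>0 by (simp add: K_def add_pos_nonneg)
    \<comment> \<open>the last entry gives \<open>K * \<delta> \<le> \<eta> / 4\<close> for the lower eigenvalue bound \<open>\<eta> = 1 / B2\<close>\<close>
    define \<delta> where "\<delta> = min \<delta>0 (min (r / 4) (1 / B2 / 4 / K))"
    have \<delta>: "0 < \<delta>" "\<delta> \<le> \<delta>0" "\<delta> \<le> r / 4" using \<delta>0 r B2 K by (simp_all add: \<delta>_def)
    have "\<delta> \<le> 1 / B2 / 4 / K" by (simp add: \<delta>_def)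
    then have K\<delta>: "K * \<delta> \<le> 1 / B2 / 4" using K by (simp only: pos_le_divide_eq mult.commute)
    obtain c where c: "0 < c" "\<forall>\<^sub>F n in sequentially. pr (?P n) (\<lambda>x.
          (SUP \<theta>\<in>- ball (\<theta>h n x) \<delta>.
             ereal (1 / real n) * loglik \<Theta> f n x \<theta>
             - ereal (1 / real n) * loglik \<Theta> f n x (\<theta>h n x)) > ereal (- c)) < ennreal e"
      using a3 e \<delta>(1) unfolding A3'_def by blast
    have \<Theta>: "open \<Theta>" using a0 by (simp add: A0_def)
    have prior: "\<And>\<theta>. \<theta> \<in> \<Theta> \<Longrightarrow> 0 \<le> \<pi> \<theta>" "set_integrable lborel \<Theta> \<pi>" "(LINT \<theta>:\<Theta>|lborel. \<pi> \<theta>) = 1"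
      "set_integrable lborel \<Theta> (\<lambda>\<theta>. \<pi> \<theta> *\<^sub>R \<theta>)"
      using model a1 by (auto simp: statistical_model_def A1'_def)
    have lam: "0 < 1 / B2" using B2 by simp
    obtain C where "0 < C" and C: "\<And>(f :: nat \<Rightarrow> real ^ 'p \<Rightarrow> 'd sample \<Rightarrow> real) n x m H a.
       regular_sample \<Theta> \<theta>s r (1 / B2) B1 K \<delta> c (\<lambda>\<theta>. f n \<theta> x) m H (real n) \<Longrightarrow> 0 < n \<Longrightarrow> 0 < a \<Longrightarrow>
       1 \<le> a * real n \<Longrightarrow> 1 \<le> \<delta>\<^sup>2 * (a * real n) \<Longrightarrow>
       set_integrable lborel \<Theta> (\<lambda>\<theta>. f n \<theta> x powr a * \<pi> \<theta>) \<Longrightarrow>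
       0 < (LINT \<theta>:\<Theta>|lborel. f n \<theta> x powr a * \<pi> \<theta>) \<Longrightarrow>
       norm (posterior_mean \<Theta> f \<pi> n a x - m) \<le> C / (a * real n)"
      using regular_sample_bias[where 'x = "'d sample" and \<Lambda> = B1, OF \<Theta> r(1) prior p lam less_imp_le[OF K] \<delta>(1,3) K\<delta> c(1)]
      by blast
    show "\<exists>B>0. \<forall>\<^sub>F n in sequentially. pr (?P n) (\<lambda>x.
        norm ((posterior_mean \<Theta> f \<pi> n (\<alpha>h n x) x - \<theta>h n x) /\<^sub>R (1 / (\<alpha> n * real n))) > B) < ennreal \<epsilon>"
    proof (intro exI conjI)
      show "0 < 2 * C" using \<open>0 < C\<close> by simp
      have ev_pd: "\<forall>\<^sub>F n in sequentially. pr (?P n) (\<lambda>x. \<not> sym_pos_def (H n x)) < ennreal e"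
        using order_tendstoD(2)[OF H_pd] e by simp
      have ev_MLE: "\<forall>\<^sub>F n in sequentially. pr (?P n) (\<lambda>x. dist (\<theta>h n x) \<theta>s > r / 4) < ennreal e"
        by (rule conv_in_probD) (use a0 r(1) e in \<open>simp_all add: A0_def\<close>)
      have ev_ratio: "\<forall>\<^sub>F n in sequentially. pr (?P n) (\<lambda>x. dist (\<alpha>h n x / \<alpha> n) 1 > 1 / 2) < ennreal e"
        by (rule conv_in_probD[OF ratio]) (use e in simp_all)
      \<comment> \<open>\<open>1 < \<rho> * \<alpha> n * n\<close> leaves room for an exponent as small as \<open>\<alpha> n / 2\<close>\<close>
      define \<rho> where "\<rho> = min (1 / 2) (\<delta>\<^sup>2 / 2)"
      have \<rho>: "0 < \<rho>" using \<delta>(1) by (simp add: \<rho>_def)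
      have ev_rate: "\<forall>\<^sub>F n in sequentially. 1 / real n / \<alpha> n < \<rho>"
        using rate unfolding tempering_rate_def much_less_def by (intro order_tendstoD(2)[OF _ \<rho>]) simp
      show "\<forall>\<^sub>F n in sequentially. pr (?P n) (\<lambda>x.
        norm ((posterior_mean \<Theta> f \<pi> n (\<alpha>h n x) x - \<theta>h n x) /\<^sub>R (1 / (\<alpha> n * real n))) > 2 * C) < ennreal \<epsilon>"
        using ev_pd B1(2) B2(2) \<delta>0(2) c(2) ev_MLE ev_ratio ev_rate eventually_ge_at_top[of 1]
      proof eventually_elim
        case (elim n)
        let ?N = "\<alpha> n * real n"
        have n: "1 \<le> n" and \<alpha>n: "0 < \<alpha> n" using elim(9) rate by (auto simp: tempering_rate_def)
        have N: "0 < ?N" using n \<alpha>n by simp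
        have "1 < \<rho> * ?N" using elim(8) n \<alpha>n by (simp add: field_simps)
        moreover have "\<rho> * ?N \<le> 1 / 2 * ?N" "\<rho> * ?N \<le> \<delta>\<^sup>2 / 2 * ?N"
          using N by (intro mult_right_mono; simp add: \<rho>_def)+
        ultimately have N_large: "1 \<le> ?N / 2" "1 \<le> \<delta>\<^sup>2 * (?N / 2)" by simp_all
        define good where "good x \<longleftrightarrow> unique_MLE \<Theta> f n x (\<theta>h n x) \<and>
            set_integrable lborel \<Theta> (\<lambda>\<theta>. f n \<theta> x powr \<alpha>h n x * \<pi> \<theta>) \<and>
            0 < (LINT \<theta>:\<Theta>|lborel. f n \<theta> x powr \<alpha>h n x * \<pi> \<theta>)" for x
        have "AE x in ?P n. unique_MLE \<Theta> f n x (\<theta>h n x)" using a0 n by (simp add: A0_def)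
        moreover have "AE x in ?P n. set_integrable lborel \<Theta> (\<lambda>\<theta>. f n \<theta> x powr \<alpha>h n x * \<pi> \<theta>) \<and>
            0 < (LINT \<theta>:\<Theta>|lborel. f n \<theta> x powr \<alpha>h n x * \<pi> \<theta>)"
          using proper n by (simp add: proper_posteriors_def)
        ultimately have "AE x in ?P n. good x" unfolding good_def by eventually_elim blast
        then have bad_0: "pr (?P n) (\<lambda>x. \<not> good x) < ennreal e"
          using e by (simp add: pr_eq_0_if_AE)
        note bad = pr_disj_less[OF elim(1) pr_disj_less[OF elim(2) pr_disj_less[OF elim(3)
              pr_disj_less[OF elim(4) pr_disj_less[OF elim(5) pr_disj_less[OF elim(6)
              pr_disj_less[OF elim(7) bad_0]]]]]]]
        have "e + (e + (e + (e + (e + (e + (e + e)))))) = \<epsilon>" by (simp add: e_def)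
        note bad = bad[unfolded this]
        have small: "norm ((posterior_mean \<Theta> f \<pi> n (\<alpha>h n x) x - \<theta>h n x) /\<^sub>R (1 / ?N)) \<le> 2 * C"
          if x: "x \<in> space (?P n)" and pd: "sym_pos_def (H n x)"
            and HB: "\<not> norm (H n x /\<^sub>R 1) > B1" "\<not> norm (matrix_inv (H n x) /\<^sub>R 1) > B2"
            and rem: "\<not> (SUP h\<in>{h. norm h / sqrt (\<alpha> n * real n) \<le> \<delta>0}.
                \<bar>remainder \<Theta> f \<theta>h \<alpha> (H n x) (S n x) n x h\<bar>
                - ereal (M / (\<alpha> n * real n) * norm h ^ 4)) > 0"
            and decay: "\<not> (SUP \<theta>\<in>- ball (\<theta>h n x) \<delta>.
                ereal (1 / real n) * loglik \<Theta> f n x \<theta>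
                - ereal (1 / real n) * loglik \<Theta> f n x (\<theta>h n x)) > ereal (- c)"
            and close: "\<not> dist (\<theta>h n x) \<theta>s > r / 4" and rat: "\<not> dist (\<alpha>h n x / \<alpha> n) 1 > 1 / 2"
            and good: "good x" for x
        proof -
          let ?m = "\<theta>h n x" and ?H = "H n x" and ?a = "\<alpha>h n x"
          have n0: "0 < n" using n by simp
          note expand = remainder_bound_real[OF rem \<alpha>n n0 \<delta>0(1)]
          have m: "?m \<in> \<Theta>" "0 < f n ?m x"
            using expand(1,2)[of 0] \<delta>0(1) by simp_all
          have f_nonneg: "0 \<le> f n \<theta> x" if "\<theta> \<in> \<Theta>" for \<theta>
            using model n x that by (simp add: statistical_model_def prob_density_def sample_law_def)
          have f_le: "f n \<theta> x \<le> f n ?m x" if "\<theta> \<in> \<Theta>" for \<theta>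
            using good that by (auto simp: good_def unique_MLE_def is_arg_max_def not_less)
          have H_low: "1 / B2 * (norm v)\<^sup>2 \<le> v \<bullet> (?H *v v)" for v
            using sym_pos_def_lower_bound[OF pd _ B2(1), of v] HB(2) by simp
          have H_up: "v \<bullet> (?H *v v) \<le> B1 * (norm v)\<^sup>2" for v
          proof -
            have "v \<bullet> (?H *v v) \<le> norm v * norm (?H *v v)" by (rule norm_cauchy_schwarz)
            also have "\<dots> \<le> norm v * (norm ?H * norm v)"
              by (intro mult_left_mono norm_matrix_vector_mult_le) simp
            also have "\<dots> \<le> norm v * (B1 * norm v)"
              using HB(1) by (intro mult_left_mono mult_right_mono) simp_all
            finally show ?thesis by (simp add: power2_eq_square mult_ac)
          qed
          have near: "\<bar>ln (f n (?m + t) x) - ln (f n ?m x) + real n * (t \<bullet> (?H *v t) / 2)\<bar>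
              \<le> real n * (K * norm t ^ 3)" if t: "norm t \<le> \<delta>0" for t
            unfolding K_def
          proof (rule cubic_term_absorbed[OF \<delta>0(1) _ abs_ge_zero _ _ _ _ t,
                where l = "\<lambda>t. ln (f n (?m + t) x) - ln (f n ?m x)" and S = "\<lambda>t. cubic_form (S n x) t / 6"
                  and q = "\<lambda>t. t \<bullet> (?H *v t) / 2"])
            show "0 < real n" using n by simp
            show "ln (f n (?m + t) x) - ln (f n ?m x) \<le> 0" if "norm t \<le> \<delta>0" for t
              using f_le[OF expand(3)[OF that]] expand(4)[OF that] by simp
            show "t \<bullet> (?H *v t) / 2 \<le> B1 / 2 * (norm t)\<^sup>2" for t using H_up[of t] by simp
            show "cubic_form (S n x) (u *\<^sub>R t) / 6 = u ^ 3 * (cubic_form (S n x) t / 6)" for u t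
              by (simp add: cubic_form_scaleR)
            show "\<bar>ln (f n (?m + t) x) - ln (f n ?m x) + real n * (t \<bullet> (?H *v t) / 2)
                - real n * (cubic_form (S n x) t / 6)\<bar> \<le> real n * \<bar>M\<bar> * norm t ^ 4"
              if "norm t \<le> \<delta>0" for t
              by (rule order_trans[OF expand(5)[OF that]]) (intro mult_right_mono mult_left_mono; simp)
          qed
          have far: "f n \<theta> x \<le> f n ?m x * exp (- c * real n)"
            if "\<theta> \<in> \<Theta>" "\<theta> \<notin> ball ?m \<delta>" for \<theta>
            using likelihood_decay_real[where \<theta>h = \<theta>h and f = f and n = n and x = x and c = c
                and \<theta> = \<theta> and \<Theta> = \<Theta> and \<delta> = \<delta>] decay m n0 that f_nonneg by blast
          have small_ball: "norm t \<le> \<delta>0" if "norm t \<le> \<delta>" for t :: "real ^ 'p"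
            using that \<delta>(2) by simp
          have "regular_sample \<Theta> \<theta>s r (1 / B2) B1 K \<delta> c (\<lambda>\<theta>. f n \<theta> x) ?m ?H (real n)"
            unfolding regular_sample_def
            by (intro conjI ballI allI impI m f_nonneg f_le H_low H_up near far expand(3,4) small_ball
                close[unfolded not_less])
          moreover have a: "0 < ?a" using \<alpha>h_pos n x by blast
          moreover have a_ge: "?N / 2 \<le> ?a * real n"
          proof -
            have "1 / 2 \<le> ?a / \<alpha> n" using rat unfolding dist_real_def by linarith
            then have "\<alpha> n / 2 \<le> ?a" using \<alpha>n by (simp add: pos_le_divide_eq)
            then have "\<alpha> n / 2 * real n \<le> ?a * real n" by (rule mult_right_mono) simp
            then show ?thesis by simp
          qed
          moreover have "1 \<le> ?a * real n" using N_large(1) a_ge by linarith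
          moreover have "1 \<le> \<delta>\<^sup>2 * (?a * real n)"
            using N_large(2) mult_left_mono[OF a_ge, of "\<delta>\<^sup>2"] by simp
          ultimately have "norm (posterior_mean \<Theta> f \<pi> n ?a x - ?m) \<le> C / (?a * real n)"
            using good n0 by (intro C) (auto simp: good_def)
          also have "\<dots> \<le> C / (?N / 2)"
            using a_ge N \<open>0 < C\<close> by (intro divide_left_mono) auto
          finally have "norm (posterior_mean \<Theta> f \<pi> n ?a x - ?m) * ?N \<le> 2 * C"
            using N by (simp add: pos_le_divide_eq mult.commute)
          then show ?thesis using N by (simp add: mult.commute)
        qed
        show ?case
          by (rule order_le_less_trans[OF pr_mono bad]) (use small not_less in blast)
      qed
    qed
  qed
  have "conv_in_prob ?P (\<lambda>n x. \<alpha> n / \<alpha> n) 1"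
    unfolding conv_in_prob_def
  proof (intro allI impI tendsto_eventually)
    fix \<epsilon> :: real assume "0 < \<epsilon>"
    have "pr (?P n) (\<lambda>x. dist (\<alpha> n / \<alpha> n) 1 > \<epsilon>) = 0" if "1 \<le> n" for n
    proof -
      have "\<alpha> n \<noteq> 0" using rate that by (auto simp: tempering_rate_def)
      then show ?thesis using \<open>0 < \<epsilon>\<close> by (simp add: pr_def)
    qed
    then show "\<forall>\<^sub>F n in sequentially. pr (?P n) (\<lambda>x. dist (\<alpha> n / \<alpha> n) 1 > \<epsilon>) = 0"
      using eventually_ge_at_top[of 1] by (rule eventually_mono[rotated])
  qed
  then show ?thesis
    using bias[of "\<lambda>n x. \<alpha> n"] bias rate assms(7) by (auto simp: tempering_rate_def)
qed

end
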